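(* Let $P\in\mathbb{C}[x,y]$ have no zeros in $\mathbb{H}^2$, satisfy $P(0,0)=0$, and have no common factors with $\bar P$, and let $L_1,\dots,L_M$, $q_1,\dots,q_M$ be the data of $[P]$ described in the context. Let $K=\max\{2L_1,\dots,2L_M\}$. Then $$\mathcal{I}^{K+1}_P\subset\prod_{j=1}^M\bigl(y+q_j(x),\,x^{2L_j}\bigr),$$ and consequently $$\prod_{j=1}^M\bigl(y+q_j(x),x^{2L_j}\bigr)=\mathcal{I}^{K+1}_P=\mathcal{I}^{\infty}_P,$$ where the left side is the product of the ideals $(y+q_j(x),x^{2L_j})$ in $\mathbb{C}\{x,y\}$.
   Context: $\mathbb{H}=\{z\in\mathbb{C}:\operatorname{Im} z>0\}$. $\bar P(x,y)=\overline{P(\bar x,\bar y)}$. $\mathbb{C}\{x,y\}$ is the ring of convergent power series at $(0,0)$. $f\in L^{\mathfrak{p}}_{loc}$ means $f\in L^{\mathfrak{p}}(U)$ for some neighborhood $U$ of $(0,0)$ in $\mathbb{R}^2$; $\mathcal{I}^{\mathfrak{p}}_P=\{Q\in\mathbb{C}\{x,y\}:Q/P\in L^{\mathfrak{p}}_{loc}\}$. By a theorem of Bickel–Knese–Pascoe–Sola, for such $P$ vanishing to order $M$ at $(0,0)$ there exist $L_1,\dots,L_M\in\mathbb{N}$ and $q_1,\dots,q_M\in\mathbb{R}[x]$ with $q_j(0)=0$, $q_j'(0)>0$, $\deg q_j<2L_j$, such that $[P]=\prod_{j=1}^M(y+q_j(x)+ix^{2L_j})$ satisfies: $P/[P]$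 and $[P]/P$ are bounded on a punctured neighborhood of $(0,0)$ in $\mathbb{R}^2$. *)

theory Defs
  imports "HOL-Analysis.Analysis" "HOL-Computational_Algebra.Polynomial"
begin

text \<open>Bivariate polynomials in C[x,y] are represented as complex poly poly:
  the outer variable is y, the coefficients are polynomials in x.\<close>

definition eval2 :: "complex poly poly \<Rightarrow> complex \<Rightarrow> complex \<Rightarrow> complex" where
  "eval2 P x y = poly (map_poly (\<lambda>a. poly a x) P) y"

text \<open>The polynomial P-bar(x,y) = conj (P (conj x, conj y)): conjugate all coefficients.\<close>
definition conj2 :: "complex poly poly \<Rightarrow> complex poly poly" where
  "conj2 P = map_poly (map_poly cnj) P"

definition vanishing_order :: "complex poly poly \<Rightarrow> nat" where
  "vanishing_order P = (LEAST n. \<exists>i j. coeff (coeff P j) i \<noteq> 0 \<and> n = i + j)"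

text \<open>Elements of C{x,y}: coefficient arrays c i j (coefficient of x^i y^j) of a
  power series converging on some polydisc around the origin.\<close>
definition conv_ps :: "(nat \<Rightarrow> nat \<Rightarrow> complex) \<Rightarrow> bool" where
  "conv_ps c \<longleftrightarrow> (\<exists>r>0. (\<lambda>(i,j). norm (c i j) * r ^ (i + j)) summable_on UNIV)"

definition ps_eval :: "(nat \<Rightarrow> nat \<Rightarrow> complex) \<Rightarrow> complex \<Rightarrow> complex \<Rightarrow> complex" where
  "ps_eval c x y = (\<Sum>\<^sub>\<infinity>(i,j)\<in>UNIV. c i j * x ^ i * y ^ j)"

definition Lp_loc :: "real \<Rightarrow> (real \<times> real \<Rightarrow> complex) \<Rightarrow> bool" where
  "Lp_loc p f \<longleftrightarrow> (\<exists>U. open U \<and> (0,0) \<in> U \<and>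
      set_borel_measurable lborel U f \<and> set_integrable lborel U (\<lambda>z. norm (f z) powr p))"

definition Linf_loc :: "(real \<times> real \<Rightarrow> complex) \<Rightarrow> bool" where
  "Linf_loc f \<longleftrightarrow> (\<exists>U C. open U \<and> (0,0) \<in> U \<and>
      set_borel_measurable lborel U f \<and> (AE z in lborel. z \<in> U \<longrightarrow> norm (f z) \<le> C))"

definition quot_real :: "(nat \<Rightarrow> nat \<Rightarrow> complex) \<Rightarrow> complex poly poly \<Rightarrow> real \<times> real \<Rightarrow> complex" where
  "quot_real Q P = (\<lambda>(x,y). ps_eval Q (of_real x) (of_real y) / eval2 P (of_real x) (of_real y))"

definition I_p :: "real \<Rightarrow> complex poly poly \<Rightarrow> (nat \<Rightarrow> nat \<Rightarrow> complex) set" where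
  "I_p p P = {Q. conv_ps Q \<and> Lp_loc p (quot_real Q P)}"

definition I_inf :: "complex poly poly \<Rightarrow> (nat \<Rightarrow> nat \<Rightarrow> complex) set" where
  "I_inf P = {Q. conv_ps Q \<and> Linf_loc (quot_real Q P)}"

text \<open>The product of the ideals (a_j, b_j), j < M, in C{x,y} is generated by the
  products prod_{j in S} a_j * prod_{j notin S} b_j, S \<subseteq> {..<M}.
  Membership: Q equals a C{x,y}-combination of these generators near the origin.\<close>
definition prod_ideal ::
  "nat \<Rightarrow> (nat \<Rightarrow> complex \<Rightarrow> complex \<Rightarrow> complex) \<Rightarrow> (nat \<Rightarrow> complex \<Rightarrow> complex \<Rightarrow> complex)
     \<Rightarrow> (nat \<Rightarrow> nat \<Rightarrow> complex) set" where
  "prod_ideal M a b = {Q. conv_ps Q \<and> (\<exists>h. (\<forall>S. conv_ps (h S)) \<and> (\<exists>e>0. \<forall>x y. norm x < e \<and> norm y < e \<longrightarrow>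
      ps_eval Q x y = (\<Sum>S\<in>Pow {..<M}. ps_eval (h S) x y *
          (\<Prod>j<M. if j \<in> S then a j x y else b j x y))))}"

end

theory Submission
  imports Defs "HOL-Complex_Analysis.Complex_Analysis" "HOL-Library.Landau_Symbols"
begin

text \<open>
  Put \<open>m\<^sub>j = 2 L\<^sub>j\<close>. Substituting \<open>y = s x\<^bsup>m\<^sub>j\<^esup> - q\<^sub>j(x)\<close> in the integral of \<open>|Q/P|\<^bsup>K+1\<^esup>\<close>
  produces the Jacobian \<open>x\<^bsup>m\<^sub>j\<^esup>\<close>; for almost every \<open>s\<close> the integral over \<open>x\<close> is finite, and
  since \<open>m\<^sub>j - (K+1) \<le> -1\<close> the order in \<open>x\<close> of \<open>Q\<close> along the curve cannot be smaller than that
  of \<open>[P]\<close>.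

  These bounds imply membership in the product ideal, by induction on the number of factors.
  Let \<open>m\<^sub>j\<close> be the largest exponent; then the order of \<open>[P]\<close> along \<open>y = s x\<^bsup>m\<^sub>j\<^esup> - q\<^sub>j(x)\<close> does
  not depend on \<open>s\<close>. As vanishing to a given order is a closed condition on \<open>s\<close>, the bound on \<open>Q\<close>
  persists at \<open>s = 0\<close>, so \<open>Q(x, -q\<^sub>j(x))\<close> is divisible by the restriction of \<open>x\<^bsup>m\<^sub>j\<^esup> G\<close>, where
  \<open>G\<close> is a generator of the remaining product whose restriction to \<open>y = -q\<^sub>j(x)\<close> has the least
  order. Hence \<open>Q = \<alpha>(x) x\<^bsup>m\<^sub>j\<^esup> G + (y + q\<^sub>j) C\<close>, and \<open>C\<close> inherits the bounds for the remaining
  factors: by maximality of \<open>m\<^sub>j\<close>, along each of the other curves \<open>y + q\<^sub>j\<close> has, for all but one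
  \<open>s\<close>, the order of \<open>y + q\<^sub>j + \<i> x\<^bsup>m\<^sub>j\<^esup>\<close>.
\<close>

section \<open>Germs of holomorphic functions of two variables\<close>

text \<open>Requiring holomorphy along every holomorphic curve, rather than in each variable
  separately, makes closure under composition immediate.\<close>
definition jointly_holomorphic_on ::
  "(complex \<times> complex \<Rightarrow> complex) \<Rightarrow> (complex \<times> complex) set \<Rightarrow> bool"
  (infixl "(jointly'_holomorphic'_on)" 50) where
  "f jointly_holomorphic_on S \<longleftrightarrow> continuous_on S f \<and>
     (\<forall>A u v. open A \<longrightarrow> u holomorphic_on A \<longrightarrow> v holomorphic_on A \<longrightarrow> (\<forall>z\<in>A. (u z, v z) \<in> S) \<longrightarrow>
        (\<lambda>z. f (u z, v z)) holomorphic_on A)"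

definition holomorphic_germ :: "(complex \<times> complex \<Rightarrow> complex) \<Rightarrow> bool" where
  "holomorphic_germ f \<longleftrightarrow> (\<exists>S. open S \<and> 0 \<in> S \<and> f jointly_holomorphic_on S)"

named_theorems holomorphic_germ_intros

lemma jointly_holomorphic_onD:
  assumes "f jointly_holomorphic_on S" "open A" "u holomorphic_on A" "v holomorphic_on A"
    "\<And>z. z \<in> A \<Longrightarrow> (u z, v z) \<in> S"
  shows "(\<lambda>z. f (u z, v z)) holomorphic_on A"
  using assms by (simp add: jointly_holomorphic_on_def)

lemma jointly_holomorphic_on_imp_continuous_on:
  "f jointly_holomorphic_on S \<Longrightarrow> continuous_on S f"
  by (simp add: jointly_holomorphic_on_def)

lemma jointly_holomorphic_on_subset:
  "f jointly_holomorphic_on S \<Longrightarrow> T \<subseteq> S \<Longrightarrow> f jointly_holomorphic_on T"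
  unfolding jointly_holomorphic_on_def by (blast intro: continuous_on_subset)

lemma jointly_holomorphic_on_compose:
  assumes f: "f jointly_holomorphic_on S"
    and g: "g jointly_holomorphic_on T" and h: "h jointly_holomorphic_on T"
    and sub: "\<And>z. z \<in> T \<Longrightarrow> (g z, h z) \<in> S"
  shows "(\<lambda>z. f (g z, h z)) jointly_holomorphic_on T"
proof -
  have "continuous_on T (\<lambda>z. (g z, h z))"
    using g h by (intro continuous_on_Pair jointly_holomorphic_on_imp_continuous_on)
  then have "continuous_on T (\<lambda>z. f (g z, h z))"
    using sub
    by (intro continuous_on_compose2[OF jointly_holomorphic_on_imp_continuous_on[OF f]]) auto
  moreover have "(\<lambda>z. f (g (u z, v z), h (u z, v z))) holomorphic_on A"
    if "open A" "u holomorphic_on A" "v holomorphic_on A" "\<forall>z\<in>A. (u z, v z) \<in> T" for A u v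
    using that sub by (intro jointly_holomorphic_onD[OF f] jointly_holomorphic_onD[OF g]
        jointly_holomorphic_onD[OF h]) auto
  ultimately show ?thesis
    by (simp add: jointly_holomorphic_on_def)
qed

lemma jointly_holomorphic_on_holomorphic_compose:
  assumes "g holomorphic_on A" "h jointly_holomorphic_on S" "h ` S \<subseteq> A"
  shows "(\<lambda>z. g (h z)) jointly_holomorphic_on S"
proof -
  have "continuous_on S (\<lambda>z. g (h z))"
    by (rule continuous_on_compose2[OF holomorphic_on_imp_continuous_on
          jointly_holomorphic_on_imp_continuous_on]) (fact assms)+
  moreover have "(\<lambda>z. g (h (u z, v z))) holomorphic_on B"
    if "open B" "u holomorphic_on B" "v holomorphic_on B" "\<forall>z\<in>B. (u z, v z) \<in> S" for B u v
  proof -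
    have "(\<lambda>z. h (u z, v z)) holomorphic_on B"
      using that by (intro jointly_holomorphic_onD[OF assms(2)]) auto
    then have "(g \<circ> (\<lambda>z. h (u z, v z))) holomorphic_on B"
      using that(4) assms(1,3) by (intro holomorphic_on_compose_gen[where t = A]) auto
    then show ?thesis
      by (simp add: o_def)
  qed
  ultimately show ?thesis
    by (simp add: jointly_holomorphic_on_def)
qed

lemma holomorphic_germ_tendsto:
  assumes "holomorphic_germ f"
  shows "(f \<longlongrightarrow> f 0) (nhds 0)"
proof -
  obtain S where "open S" "0 \<in> S" "f jointly_holomorphic_on S"
    using assms by (auto simp: holomorphic_germ_def)
  then have "isCont f 0"
    using jointly_holomorphic_on_imp_continuous_on continuous_on_eq_continuous_at by blast
  then show ?thesis
    by (simp add: isCont_def tendsto_at_iff_tendsto_nhds)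
qed

lemma filterlim_holomorphic_germ_Pair:
  assumes "holomorphic_germ g" "holomorphic_germ h" "g 0 = 0" "h 0 = 0"
  shows "filterlim (\<lambda>z. (g z, h z)) (nhds 0) (nhds 0)"
  using tendsto_Pair[OF assms(1,2)[THEN holomorphic_germ_tendsto]] assms(3,4)
  by (simp add: zero_prod_def)

lemma holomorphic_germ_const [holomorphic_germ_intros]: "holomorphic_germ (\<lambda>z. a)"
  unfolding holomorphic_germ_def jointly_holomorphic_on_def by (intro exI[of _ UNIV]) auto

lemma holomorphic_germ_fst [holomorphic_germ_intros]: "holomorphic_germ fst"
  unfolding holomorphic_germ_def jointly_holomorphic_on_def
  by (intro exI[of _ UNIV]) (auto intro: continuous_intros)

lemma holomorphic_germ_snd [holomorphic_germ_intros]: "holomorphic_germ snd"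
  unfolding holomorphic_germ_def jointly_holomorphic_on_def
  by (intro exI[of _ UNIV]) (auto intro: continuous_intros)

lemma holomorphic_germ_compose:
  assumes f: "holomorphic_germ f" and g: "holomorphic_germ g" and h: "holomorphic_germ h"
    and "g 0 = 0" "h 0 = 0"
  shows "holomorphic_germ (\<lambda>z. f (g z, h z))"
proof -
  obtain S T U where S: "open S" "0 \<in> S" "f jointly_holomorphic_on S"
    and T: "open T" "0 \<in> T" "g jointly_holomorphic_on T"
    and U: "open U" "0 \<in> U" "h jointly_holomorphic_on U"
    using f g h by (auto simp: holomorphic_germ_def)
  define V where "V = (T \<inter> U) \<inter> (\<lambda>z. (g z, h z)) -` S"
  have gh: "g jointly_holomorphic_on T \<inter> U" "h jointly_holomorphic_on T \<inter> U"
    using T U by (auto intro: jointly_holomorphic_on_subset)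
  then have "open V"
    unfolding V_def using S(1) T(1) U(1) jointly_holomorphic_on_imp_continuous_on
    by (intro continuous_open_preimage continuous_on_Pair open_Int) blast+
  moreover have "0 \<in> V"
    using S T U assms(4,5) by (simp add: V_def zero_prod_def)
  moreover have "(\<lambda>z. f (g z, h z)) jointly_holomorphic_on V"
    using S(3) gh by (intro jointly_holomorphic_on_compose[of f S])
      (auto simp: V_def intro: jointly_holomorphic_on_subset)
  ultimately show ?thesis
    by (auto simp: holomorphic_germ_def)
qed

lemma holomorphic_germ_analytic_compose:
  assumes "g analytic_on {h 0}" "holomorphic_germ h"
  shows "holomorphic_germ (\<lambda>z. g (h z))"
proof -
  obtain A where A: "open A" "h 0 \<in> A" "g holomorphic_on A"
    using assms(1) by (auto simp: analytic_at)
  obtain S where S: "open S" "0 \<in> S" "h jointly_holomorphic_on S"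
    using assms(2) by (auto simp: holomorphic_germ_def)
  have "open (S \<inter> h -` A)"
    using A(1) S continuous_open_preimage jointly_holomorphic_on_imp_continuous_on by blast
  moreover have "(\<lambda>z. g (h z)) jointly_holomorphic_on S \<inter> h -` A"
    using jointly_holomorphic_on_subset[OF S(3)]
    by (rule jointly_holomorphic_on_holomorphic_compose[OF A(3)]) auto
  ultimately show ?thesis
    using A(2) S(2) unfolding holomorphic_germ_def by blast
qed

lemma analytic_on_holomorphic_germ_curve:
  assumes f: "holomorphic_germ f" and "u analytic_on {0}" "v analytic_on {0}" "u 0 = 0" "v 0 = 0"
  shows "(\<lambda>z. f (u z, v z)) analytic_on {0}"
proof -
  obtain S where S: "open S" "0 \<in> S" "f jointly_holomorphic_on S"
    using f by (auto simp: holomorphic_germ_def)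
  obtain A where A: "open A" "0 \<in> A" "u holomorphic_on A" "v holomorphic_on A"
    using assms(2,3) analytic_at_two by blast
  define B where "B = A \<inter> (\<lambda>z. (u z, v z)) -` S"
  have "open B"
    unfolding B_def using A S(1) holomorphic_on_imp_continuous_on
    by (intro continuous_open_preimage continuous_on_Pair) blast+
  moreover have "0 \<in> B"
    using A(2) S(2) assms(4,5) by (simp add: B_def zero_prod_def)
  moreover have "(\<lambda>z. f (u z, v z)) holomorphic_on B"
    using A \<open>open B\<close> by (intro jointly_holomorphic_onD[OF S(3)])
      (auto simp: B_def intro: holomorphic_on_subset)
  ultimately show ?thesis
    by (auto simp: analytic_at)
qed

lemma jointly_holomorphic_on_add:
  assumes "f jointly_holomorphic_on S" "g jointly_holomorphic_on S"
  shows "(\<lambda>z. f z + g z) jointly_holomorphic_on S"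
  using assms unfolding jointly_holomorphic_on_def
  by (intro conjI allI impI continuous_on_add holomorphic_on_add) simp_all

lemma jointly_holomorphic_on_mult:
  assumes "f jointly_holomorphic_on S" "g jointly_holomorphic_on S"
  shows "(\<lambda>z. f z * g z) jointly_holomorphic_on S"
  using assms unfolding jointly_holomorphic_on_def
  by (intro conjI allI impI continuous_on_mult holomorphic_on_mult) simp_all

lemma holomorphic_germs_common_domain:
  assumes "holomorphic_germ f" "holomorphic_germ g"
  obtains S where "open S" "0 \<in> S" "f jointly_holomorphic_on S" "g jointly_holomorphic_on S"
proof -
  obtain S T where "open S" "0 \<in> S" "f jointly_holomorphic_on S"
    and "open T" "0 \<in> T" "g jointly_holomorphic_on T"
    using assms by (auto simp: holomorphic_germ_def)
  then show ?thesis
    by (intro that[of "S \<inter> T"]) (auto intro: jointly_holomorphic_on_subset)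
qed

lemma holomorphic_germ_add [holomorphic_germ_intros]:
  assumes "holomorphic_germ f" "holomorphic_germ g"
  shows "holomorphic_germ (\<lambda>z. f z + g z)"
  unfolding holomorphic_germ_def
  by (rule holomorphic_germs_common_domain[OF assms]) (blast intro: jointly_holomorphic_on_add)

lemma holomorphic_germ_mult [holomorphic_germ_intros]:
  assumes "holomorphic_germ f" "holomorphic_germ g"
  shows "holomorphic_germ (\<lambda>z. f z * g z)"
  unfolding holomorphic_germ_def
  by (rule holomorphic_germs_common_domain[OF assms]) (blast intro: jointly_holomorphic_on_mult)

lemma holomorphic_germ_diff [holomorphic_germ_intros]:
  assumes "holomorphic_germ f" "holomorphic_germ g"
  shows "holomorphic_germ (\<lambda>z. f z - g z)"
proof -
  have "holomorphic_germ (\<lambda>z. f z + (- 1) * g z)"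
    by (intro holomorphic_germ_intros assms)
  then show ?thesis
    by simp
qed

lemma holomorphic_germ_power [holomorphic_germ_intros]:
  "holomorphic_germ f \<Longrightarrow> holomorphic_germ (\<lambda>z. f z ^ n)"
  by (induction n) (auto intro: holomorphic_germ_intros)

lemma holomorphic_germ_prod [holomorphic_germ_intros]:
  "(\<And>i. i \<in> I \<Longrightarrow> holomorphic_germ (f i)) \<Longrightarrow> holomorphic_germ (\<lambda>z. \<Prod>i\<in>I. f i z)"
  by (induction I rule: infinite_finite_induct) (auto intro: holomorphic_germ_intros)

lemma holomorphic_germ_poly [holomorphic_germ_intros]:
  "holomorphic_germ f \<Longrightarrow> holomorphic_germ (\<lambda>z. poly p (f z))"
  by (induction p) (auto intro: holomorphic_germ_intros)

lemma holomorphic_on_slices: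
  assumes "f jointly_holomorphic_on A \<times> B" "open A" "open B"
  shows "y \<in> B \<Longrightarrow> (\<lambda>x. f (x, y)) holomorphic_on A"
    and "x \<in> A \<Longrightarrow> (\<lambda>y. f (x, y)) holomorphic_on B"
  using assms by (auto intro!: jointly_holomorphic_onD[OF assms(1)] holomorphic_intros)

lemma eventually_nhds_0_iff_polydisc:
  "(\<forall>\<^sub>F z in nhds (0 :: 'a :: real_normed_vector \<times> 'b :: real_normed_vector). Pr z) \<longleftrightarrow>
     (\<exists>e>0. \<forall>x y. norm x < e \<and> norm y < e \<longrightarrow> Pr (x, y))"
proof
  assume "\<forall>\<^sub>F z in nhds (0 :: 'a \<times> 'b). Pr z"
  then obtain d where "d > 0" and near: "\<And>z. dist z 0 < d \<Longrightarrow> Pr z"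
    unfolding eventually_nhds_metric by blast
  have "Pr (x, y)" if "norm x < d / 2" "norm y < d / 2" for x y
    using near[of "(x, y)"] norm_Pair_le[of x y] that by simp
  then show "\<exists>e>0. \<forall>x y. norm x < e \<and> norm y < e \<longrightarrow> Pr (x, y)"
    using \<open>d > 0\<close> by (intro exI[of _ "d / 2"]) auto
next
  assume "\<exists>e>0. \<forall>x y. norm x < e \<and> norm y < e \<longrightarrow> Pr (x, y)"
  then obtain e where "e > 0" and near: "\<And>x y. norm x < e \<Longrightarrow> norm y < e \<Longrightarrow> Pr (x, y)"
    by blast
  have "Pr z" if "dist z 0 < e" for z
    using near[of "fst z" "snd z"] that
      norm_fst_le[of "fst z" "snd z"] norm_snd_le[of "snd z" "fst z"]
    by simp
  then show "\<forall>\<^sub>F z in nhds (0 :: 'a \<times> 'b). Pr z"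
    using \<open>e > 0\<close> unfolding eventually_nhds_metric by blast
qed

section \<open>Convergent power series and Osgood's lemma\<close>

definition ps_abs_summable :: "real \<Rightarrow> (nat \<Rightarrow> nat \<Rightarrow> complex) \<Rightarrow> bool" where
  "ps_abs_summable r c \<longleftrightarrow> (\<lambda>(i,j). norm (c i j) * r ^ (i + j)) summable_on UNIV"

lemma conv_ps_iff_ps_abs_summable: "conv_ps c \<longleftrightarrow> (\<exists>r>0. ps_abs_summable r c)"
  by (simp add: conv_ps_def ps_abs_summable_def)

lemma norm_ps_term_le:
  fixes x y :: complex
  assumes "norm x \<le> r" "norm y \<le> r"
  shows "norm (c i j * x ^ i * y ^ j) \<le> norm (c i j) * r ^ (i + j)"
proof -
  have "norm (c i j * x ^ i * y ^ j) = norm (c i j) * (norm x ^ i * norm y ^ j)"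
    by (simp add: norm_mult norm_power)
  also have "\<dots> \<le> norm (c i j) * (r ^ i * r ^ j)"
    using assms order_trans[OF norm_ge_zero assms(1)]
    by (intro mult_left_mono mult_mono power_mono) auto
  finally show ?thesis
    by (simp add: power_add)
qed

lemma has_sum_ps_eval:
  assumes "ps_abs_summable r c" "norm x \<le> r" "norm y \<le> r"
  shows "((\<lambda>(i,j). c i j * x ^ i * y ^ j) has_sum ps_eval c x y) UNIV"
  unfolding ps_eval_def
proof (rule has_sum_infsum, rule abs_summable_summable,
    rule Infinite_Sum.abs_summable_on_comparison_test')
  show "(\<lambda>(i,j). norm (c i j) * r ^ (i + j)) summable_on UNIV"
    using assms(1) by (simp add: ps_abs_summable_def)
  show "norm (case p of (i, j) \<Rightarrow> c i j * x ^ i * y ^ j)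
      \<le> (case p of (i, j) \<Rightarrow> norm (c i j) * r ^ (i + j))" for p
    using norm_ps_term_le[OF assms(2,3), of c] by (cases p) auto
qed

lemma uniform_limit_ps_eval:
  assumes "ps_abs_summable r c"
  shows "uniform_limit (cball 0 r \<times> cball 0 r)
     (\<lambda>X z. \<Sum>(i,j)\<in>X. c i j * fst z ^ i * snd z ^ j)
     (\<lambda>z. ps_eval c (fst z) (snd z)) (finite_subsets_at_top UNIV)"
proof -
  have "uniform_limit (cball 0 r \<times> cball 0 r)
     (\<lambda>X z. \<Sum>p\<in>X. c (fst p) (snd p) * fst z ^ fst p * snd z ^ snd p)
     (\<lambda>z. \<Sum>\<^sub>\<infinity>p\<in>UNIV. c (fst p) (snd p) * fst z ^ fst p * snd z ^ snd p)
     (finite_subsets_at_top UNIV)"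
  proof (rule Weierstrass_m_test_general[OF _ assms[unfolded ps_abs_summable_def]])
    fix p :: "nat \<times> nat" and z :: "complex \<times> complex"
    assume "z \<in> cball 0 r \<times> cball 0 r"
    then show "norm (c (fst p) (snd p) * fst z ^ fst p * snd z ^ snd p)
       \<le> (case p of (i, j) \<Rightarrow> norm (c i j) * r ^ (i + j))"
      using norm_ps_term_le[of "fst z" r "snd z" c "fst p" "snd p"] by (cases p) auto
  qed
  then show ?thesis
    by (simp add: ps_eval_def case_prod_unfold)
qed

lemma holomorphic_on_uniform_limit:
  assumes "open A" and hol: "\<forall>\<^sub>F n in F. f n holomorphic_on A" and lim: "uniform_limit A f g F"
    and "F \<noteq> bot"
  shows "g holomorphic_on A"
proof -
  have "g field_differentiable at w" if w: "w \<in> A" for w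
  proof -
    obtain d where d: "d > 0" "cball w d \<subseteq> A"
      using \<open>open A\<close> w open_contains_cball by blast
    then have "ball w d \<subseteq> A"
      using ball_subset_cball by blast
    then have "\<forall>\<^sub>F n in F. continuous_on (cball w d) (f n) \<and> f n holomorphic_on ball w d"
      using holomorphic_on_subset holomorphic_on_imp_continuous_on d(2)
      by (intro eventually_mono[OF hol]) blast
    then have "g holomorphic_on ball w d"
      using uniform_limit_on_subset[OF lim d(2)] \<open>F \<noteq> bot\<close> by (rule holomorphic_uniform_limit)
    then show ?thesis
      using d(1) by (auto intro: holomorphic_on_imp_differentiable_at)
  qed
  then show ?thesis
    by (auto simp: holomorphic_on_def intro: field_differentiable_at_within)
qed

lemma ps_eval_jointly_holomorphic_on:
  assumes "ps_abs_summable r c"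
  shows "(\<lambda>z. ps_eval c (fst z) (snd z)) jointly_holomorphic_on ball 0 r \<times> ball 0 r"
proof -
  note lim = uniform_limit_on_subset[OF uniform_limit_ps_eval[OF assms], of "ball 0 r \<times> ball 0 r"]
  have "continuous_on (ball 0 r \<times> ball 0 r) (\<lambda>z. ps_eval c (fst z) (snd z))"
    by (rule uniform_limit_theorem[OF _ lim])
       (auto simp: always_eventually case_prod_unfold intro!: continuous_intros always_eventually)
  moreover have "(\<lambda>z. ps_eval c (u z) (v z)) holomorphic_on A"
    if A: "open A" and u: "u holomorphic_on A" and v: "v holomorphic_on A"
      and uv: "\<forall>z\<in>A. (u z, v z) \<in> ball 0 r \<times> ball 0 r" for A u v
  proof (rule holomorphic_on_uniform_limit[OF A])
    show "\<forall>\<^sub>F X in finite_subsets_at_top UNIV.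
        (\<lambda>z. \<Sum>(i,j)\<in>X. c i j * u z ^ i * v z ^ j) holomorphic_on A"
      unfolding case_prod_unfold by (intro always_eventually allI holomorphic_intros u v)
    have "uniform_limit A (\<lambda>X z. \<Sum>(i,j)\<in>X. c i j * fst (u z, v z) ^ i * snd (u z, v z) ^ j)
        (\<lambda>z. ps_eval c (fst (u z, v z)) (snd (u z, v z))) (finite_subsets_at_top UNIV)"
      using uv by (intro uniform_limit_compose'[OF lim]) auto
    then show "uniform_limit A (\<lambda>X z. \<Sum>(i,j)\<in>X. c i j * u z ^ i * v z ^ j)
        (\<lambda>z. ps_eval c (u z) (v z)) (finite_subsets_at_top UNIV)"
      by simp
  qed simp
  ultimately show ?thesis
    by (simp add: jointly_holomorphic_on_def)
qed

lemma holomorphic_germ_ps_eval: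
  assumes "conv_ps c"
  shows "holomorphic_germ (\<lambda>z. ps_eval c (fst z) (snd z))"
proof -
  obtain r where "r > 0" "ps_abs_summable r c"
    using assms by (auto simp: conv_ps_iff_ps_abs_summable)
  then show ?thesis
    unfolding holomorphic_germ_def using ps_eval_jointly_holomorphic_on
    by (intro exI[of _ "ball 0 r \<times> ball 0 r"]) (auto simp: zero_prod_def open_Times)
qed

lemma norm_taylor_coeff_le:
  assumes "g holomorphic_on ball 0 r" "0 < \<rho>" "\<rho> < r" "\<And>z. norm z = \<rho> \<Longrightarrow> norm (g z) \<le> B"
  shows "norm ((deriv ^^ n) g 0 / fact n) \<le> B / \<rho> ^ n"
proof -
  have "cball 0 \<rho> \<subseteq> ball (0 :: complex) r" "ball 0 \<rho> \<subseteq> ball (0 :: complex) r"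
    using assms(3) by auto
  then have "norm ((deriv ^^ n) g 0) \<le> fact n * B / \<rho> ^ n"
    using assms by (intro Cauchy_inequality)
      (auto intro: holomorphic_on_subset holomorphic_on_imp_continuous_on)
  then show ?thesis
    by (simp add: norm_divide field_simps)
qed

lemma norm_taylor_remainder_quotient_le:
  assumes g: "g holomorphic_on ball 0 r" and \<rho>: "0 < \<rho>" "\<rho> < r"
    and bound: "\<And>z. norm z = \<rho> \<Longrightarrow> norm (g z) \<le> B"
    and y: "y \<noteq> 0" "norm y \<le> \<rho> / 2"
  defines "a \<equiv> \<lambda>n. (deriv ^^ n) g 0 / fact n"
  shows "norm ((g y - (\<Sum>i<j. a i * y ^ i)) / y ^ j - a j) \<le> 2 * B / \<rho> ^ Suc j * norm y"
proof -
  have coeff_le: "norm (a n) \<le> B / \<rho> ^ n" for n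
    unfolding a_def using g \<rho> bound by (rule norm_taylor_coeff_le)
  have "B \<ge> 0"
    using order_trans[OF norm_ge_zero coeff_le[of 0]] by simp
  have "y \<in> ball 0 r"
    using y \<rho> by simp
  from holomorphic_power_series[OF g this] have "(\<lambda>n. a n * y ^ n) sums g y"
    by (simp add: a_def)
  then have "(\<lambda>n. a (n + Suc j) * y ^ (n + Suc j) / y ^ j)
      sums ((g y - (\<Sum>i<Suc j. a i * y ^ i)) / y ^ j)"
    by (intro sums_divide sums_split_initial_segment)
  then have remainder: "(\<lambda>n. a (n + Suc j) * (y * y ^ n))
      sums ((g y - (\<Sum>i<j. a i * y ^ i)) / y ^ j - a j)"
    using y by (simp add: field_simps power_add)
  have geometric: "(\<lambda>n. B / \<rho> ^ Suc j * norm y * (1/2) ^ n) sums (B / \<rho> ^ Suc j * norm y * 2)"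
    using sums_mult[OF geometric_sums[of "1/2 :: real"], of "B / \<rho> ^ Suc j * norm y"] by simp
  have "norm (a (n + Suc j) * (y * y ^ n)) \<le> B / \<rho> ^ Suc j * norm y * (1/2) ^ n" for n
  proof -
    have "norm (a (n + Suc j) * (y * y ^ n)) = norm (a (n + Suc j)) * (norm y * norm y ^ n)"
      by (simp add: norm_mult norm_power)
    also have "\<dots> \<le> B / \<rho> ^ (n + Suc j) * (norm y * (\<rho> / 2) ^ n)"
      using y \<open>B \<ge> 0\<close> \<rho> by (intro mult_mono[OF coeff_le] power_mono mult_left_mono) auto
    also have "\<dots> = B / \<rho> ^ Suc j * norm y * (1/2) ^ n"
      using \<rho> by (simp add: power_add power_divide field_simps)
    finally show ?thesis .
  qed
  from norm_sums_le[OF remainder geometric this] show ?thesis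
    by (simp add: mult.commute mult.left_commute)
qed

definition taylor_coeff_snd :: "(complex \<times> complex \<Rightarrow> complex) \<Rightarrow> nat \<Rightarrow> complex \<Rightarrow> complex" where
  "taylor_coeff_snd f j x = (deriv ^^ j) (\<lambda>y. f (x, y)) 0 / fact j"

lemma sums_taylor_coeff_snd:
  assumes "f jointly_holomorphic_on ball 0 r \<times> ball 0 r" "norm x < r" "norm y < r"
  shows "(\<lambda>j. taylor_coeff_snd f j x * y ^ j) sums f (x, y)"
proof -
  have "(\<lambda>y. f (x, y)) holomorphic_on ball 0 r"
    using assms(2) by (intro holomorphic_on_slices(2)[OF assms(1) open_ball open_ball]) simp
  from holomorphic_power_series[OF this, of y] show ?thesis
    using assms(3) by (simp add: taylor_coeff_snd_def)
qed

lemma uniform_limit_taylor_coeff_snd: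
  assumes "0 < r" and f: "f jointly_holomorphic_on ball 0 r \<times> ball 0 r"
    and bound: "\<And>x y. norm x < r \<Longrightarrow> norm y < r \<Longrightarrow> norm (f (x, y)) \<le> B"
  shows "uniform_limit (ball 0 r)
    (\<lambda>y x. (f (x, y) - (\<Sum>i<j. taylor_coeff_snd f i x * y ^ i)) / y ^ j)
    (taylor_coeff_snd f j) (at 0)"
    (is "uniform_limit _ ?quotient _ _")
proof (rule uniform_limitI)
  fix e :: real assume "e > 0"
  define \<rho> where "\<rho> = r / 2"
  have \<rho>: "0 < \<rho>" "\<rho> < r"
    using \<open>0 < r\<close> by (auto simp: \<rho>_def)
  have close: "norm (?quotient y x - taylor_coeff_snd f j x) \<le> 2 * B / \<rho> ^ Suc j * norm y"
    if "norm x < r" "y \<noteq> 0" "norm y < \<rho> / 2" for x y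
    unfolding taylor_coeff_snd_def
  proof (rule norm_taylor_remainder_quotient_le)
    show "(\<lambda>y. f (x, y)) holomorphic_on ball 0 r"
      using that by (intro holomorphic_on_slices(2)[OF f open_ball open_ball]) simp
  qed (use that \<rho> bound in auto)
  have "\<forall>\<^sub>F y in at (0::complex). y \<noteq> 0 \<and> norm y < \<rho> / 2"
    using \<rho>(1) by (auto simp: eventually_at intro!: exI[of _ "\<rho> / 2"])
  moreover have "((\<lambda>y::complex. 2 * B / \<rho> ^ Suc j * norm y) \<longlongrightarrow> 0) (at 0)"
    by (rule tendsto_eq_intros | simp)+
  then have "\<forall>\<^sub>F y::complex in at 0. 2 * B / \<rho> ^ Suc j * norm y < e"
    using \<open>e > 0\<close> by (rule order_tendstoD)
  ultimately show "\<forall>\<^sub>F y in at 0. \<forall>x\<in>ball 0 r. dist (?quotient y x) (taylor_coeff_snd f j x) < e"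
    by eventually_elim (use close in \<open>fastforce simp: dist_norm\<close>)
qed

lemma holomorphic_on_taylor_coeff_snd:
  assumes "0 < r" and f: "f jointly_holomorphic_on ball 0 r \<times> ball 0 r"
    and bound: "\<And>x y. norm x < r \<Longrightarrow> norm y < r \<Longrightarrow> norm (f (x, y)) \<le> B"
  shows "taylor_coeff_snd f j holomorphic_on ball 0 r"
proof (induction j rule: less_induct)
  case (less j)
  have "\<forall>\<^sub>F y in at (0::complex). y \<noteq> 0 \<and> norm y < r"
    using \<open>0 < r\<close> by (auto simp: eventually_at)
  then have "\<forall>\<^sub>F y in at 0.
      (\<lambda>x. (f (x, y) - (\<Sum>i<j. taylor_coeff_snd f i x * y ^ i)) / y ^ j) holomorphic_on ball 0 r"
  proof eventually_elim
    case (elim y)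
    then show ?case
      by (intro holomorphic_intros holomorphic_on_slices(1)[OF f open_ball open_ball] less.IH) auto
  qed
  then show ?case
    using uniform_limit_taylor_coeff_snd[OF \<open>0 < r\<close> f bound]
    by (rule holomorphic_on_uniform_limit[OF open_ball]) auto
qed

lemma ps_abs_summable_of_coeff_bound:
  assumes "\<And>i j. norm (c i j) \<le> B / \<rho> ^ (i + j)" "\<rho> > 0"
  shows "ps_abs_summable (\<rho> / 2) c"
  unfolding ps_abs_summable_def
proof (rule summable_on_comparison_test)
  have geometric: "(\<lambda>n. (1/2 :: real) ^ n) summable_on UNIV"
    by (intro norm_summable_imp_summable_on) (auto simp: power_divide[symmetric])
  have "(\<lambda>(i,j). (1/2) ^ i * (1/2 :: real) ^ j) summable_on UNIV \<times> UNIV"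
    by (rule summable_on_SigmaI[where g = "\<lambda>i. (1/2) ^ i * (\<Sum>\<^sub>\<infinity>j. (1/2) ^ j)"])
       (auto intro!: has_sum_cmult_right has_sum_infsum summable_on_cmult_left geometric)
  then show "(\<lambda>p. B * (case p of (i,j) \<Rightarrow> (1/2) ^ i * (1/2 :: real) ^ j)) summable_on UNIV"
    by (intro summable_on_cmult_right) simp
next
  fix p :: "nat \<times> nat"
  obtain i j where p: "p = (i, j)"
    by (cases p)
  have "norm (c i j) * (\<rho> / 2) ^ (i + j) \<le> B / \<rho> ^ (i + j) * (\<rho> / 2) ^ (i + j)"
    using assms by (intro mult_right_mono) auto
  also have "\<dots> = B * ((1/2) ^ i * (1/2) ^ j)"
    using assms(2) by (simp add: power_add power_divide field_simps)
  finally show "(case p of (i, j) \<Rightarrow> norm (c i j) * (\<rho> / 2) ^ (i + j))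
      \<le> B * (case p of (i,j) \<Rightarrow> (1/2) ^ i * (1/2) ^ j)"
    by (simp add: p)
  show "0 \<le> (case p of (i, j) \<Rightarrow> norm (c i j) * (\<rho> / 2) ^ (i + j))"
    using assms(2) by (simp add: p)
qed

lemma sums_ps_eval_in_snd:
  assumes "ps_abs_summable r c" "norm x \<le> r" "norm y \<le> r"
    and row: "\<And>j. (\<lambda>i. c i j * x ^ i) sums a j"
  shows "(\<lambda>j. a j * y ^ j) sums ps_eval c x y"
proof -
  have "((\<lambda>(i,j). c i j * x ^ i * y ^ j) has_sum ps_eval c x y) (UNIV \<times> UNIV)"
    using has_sum_ps_eval[OF assms(1-3)] by simp
  then have swapped: "((\<lambda>(j,i). c i j * x ^ i * y ^ j) has_sum ps_eval c x y) (UNIV \<times> UNIV)"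
    using iffD1[OF has_sum_swap] by (fastforce simp: case_prod_unfold)
  have "((\<lambda>i. c i j * x ^ i * y ^ j) has_sum (a j * y ^ j)) UNIV" for j
  proof -
    have "(\<lambda>i. c i j * x ^ i * y ^ j) summable_on UNIV"
      using summable_on_SigmaD1[OF has_sum_imp_summable[OF swapped], of j] by simp
    then have sum_row: "((\<lambda>i. c i j * x ^ i * y ^ j) has_sum (\<Sum>\<^sub>\<infinity>i. c i j * x ^ i * y ^ j)) UNIV"
      by (rule has_sum_infsum)
    moreover have "(\<Sum>\<^sub>\<infinity>i. c i j * x ^ i * y ^ j) = a j * y ^ j"
      by (rule sums_unique2[OF has_sum_imp_sums[OF sum_row] sums_mult2[OF row]])
    ultimately show ?thesis
      by simp
  qed
  then have "((\<lambda>j. a j * y ^ j) has_sum ps_eval c x y) UNIV"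
    by (intro has_sum_SigmaD[OF swapped]) simp
  then show ?thesis
    by (rule has_sum_imp_sums)
qed

lemma holomorphic_germ_bounded_polydisc:
  assumes "holomorphic_germ f"
  obtains r B where "0 < r" "f jointly_holomorphic_on ball 0 r \<times> ball 0 r"
    "\<And>x y. norm x < r \<Longrightarrow> norm y < r \<Longrightarrow> norm (f (x, y)) \<le> B"
proof -
  obtain S where S: "open S" "0 \<in> S" "f jointly_holomorphic_on S"
    using assms by (auto simp: holomorphic_germ_def)
  have "\<forall>\<^sub>F z in nhds 0. norm (f z) < norm (f 0) + 1"
    using tendsto_norm[OF holomorphic_germ_tendsto[OF assms]] by (rule order_tendstoD) simp
  moreover have "\<forall>\<^sub>F z in nhds 0. z \<in> S"
    using S(1,2) by (rule eventually_nhds_in_open)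
  ultimately have "\<forall>\<^sub>F z in nhds 0. z \<in> S \<and> norm (f z) < norm (f 0) + 1"
    by eventually_elim simp
  then obtain r where "r > 0"
    and inside: "\<And>x y. norm x < r \<Longrightarrow> norm y < r \<Longrightarrow> (x, y) \<in> S \<and> norm (f (x, y)) < norm (f 0) + 1"
    unfolding eventually_nhds_0_iff_polydisc by blast
  moreover have "f jointly_holomorphic_on ball 0 r \<times> ball 0 r"
    using inside by (intro jointly_holomorphic_on_subset[OF S(3)]) auto
  ultimately show ?thesis
    by (intro that[of r "norm (f 0) + 1"]) (auto intro: less_imp_le)
qed

proposition osgood:
  assumes "holomorphic_germ f"
  obtains c where "conv_ps c" "\<forall>\<^sub>F z in nhds 0. f z = ps_eval c (fst z) (snd z)"
proof -
  obtain r B where "0 < r" and f: "f jointly_holomorphic_on ball 0 r \<times> ball 0 r"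
    and bound: "\<And>x y. norm x < r \<Longrightarrow> norm y < r \<Longrightarrow> norm (f (x, y)) \<le> B"
    using holomorphic_germ_bounded_polydisc[OF assms] by blast
  define \<rho> where "\<rho> = r / 2"
  have \<rho>: "0 < \<rho>" "\<rho> < r"
    using \<open>0 < r\<close> by (auto simp: \<rho>_def)
  define c where "c i j = (deriv ^^ i) (taylor_coeff_snd f j) 0 / fact i" for i j
  have hol: "taylor_coeff_snd f j holomorphic_on ball 0 r" for j
    using \<open>0 < r\<close> f bound by (rule holomorphic_on_taylor_coeff_snd)
  have "norm (taylor_coeff_snd f j x) \<le> B / \<rho> ^ j" if "norm x < r" for j x
    unfolding taylor_coeff_snd_def
  proof (rule norm_taylor_coeff_le)
    show "(\<lambda>y. f (x, y)) holomorphic_on ball 0 r"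
      using that by (intro holomorphic_on_slices(2)[OF f open_ball open_ball]) simp
  qed (use that \<rho> bound in auto)
  then have "norm (c i j) \<le> B / \<rho> ^ j / \<rho> ^ i" for i j
    unfolding c_def using \<rho> by (intro norm_taylor_coeff_le[OF hol]) auto
  then have norm_c: "norm (c i j) \<le> B / \<rho> ^ (i + j)" for i j
    by (simp add: power_add mult.commute)
  have summable: "ps_abs_summable (\<rho> / 2) c"
    using norm_c \<rho>(1) by (rule ps_abs_summable_of_coeff_bound)
  have "f (x, y) = ps_eval c x y" if "norm x < \<rho> / 2" "norm y < \<rho> / 2" for x y
  proof -
    have x: "norm x < r" and y: "norm y < r"
      using that \<rho> by auto
    have "(\<lambda>i. c i j * x ^ i) sums taylor_coeff_snd f j x" for j
      using holomorphic_power_series[OF hol, of x j] x by (simp add: c_def)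
    then have "(\<lambda>j. taylor_coeff_snd f j x * y ^ j) sums ps_eval c x y"
      using that by (intro sums_ps_eval_in_snd[OF summable]) auto
    then show ?thesis
      using sums_taylor_coeff_snd[OF f x y] sums_unique2 by blast
  qed
  then have "\<forall>\<^sub>F z in nhds 0. f z = ps_eval c (fst z) (snd z)"
    using \<rho>(1) unfolding eventually_nhds_0_iff_polydisc by (intro exI[of _ "\<rho> / 2"]) auto
  moreover have "conv_ps c"
    using summable \<rho>(1) by (auto simp: conv_ps_iff_ps_abs_summable intro!: exI[of _ "\<rho> / 2"])
  ultimately show ?thesis
    using that by blast
qed

section \<open>Division\<close>

lemma ps_abs_summable_shift_snd:
  assumes "ps_abs_summable r c" "r > 0"
  shows "ps_abs_summable r (\<lambda>i j. c i (Suc j))"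
proof -
  define shift :: "nat \<times> nat \<Rightarrow> nat \<times> nat" where "shift = (\<lambda>(i,j). (i, Suc j))"
  have "inj shift"
    by (auto simp: shift_def inj_on_def)
  have "(\<lambda>(i,j). norm (c i j) * r ^ (i + j)) summable_on range shift"
    using assms(1) unfolding ps_abs_summable_def by (rule summable_on_subset) simp
  then have "(\<lambda>p. (1 / r) * ((\<lambda>(i,j). norm (c i j) * r ^ (i + j)) \<circ> shift) p) summable_on UNIV"
    unfolding summable_on_reindex[OF \<open>inj shift\<close>] by (rule summable_on_cmult_right)
  also have "(\<lambda>p. (1 / r) * ((\<lambda>(i,j). norm (c i j) * r ^ (i + j)) \<circ> shift) p)
      = (\<lambda>(i,j). norm (c i (Suc j)) * r ^ (i + j))"
    using assms(2) by (auto simp: fun_eq_iff shift_def)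
  finally show ?thesis
    by (simp add: ps_abs_summable_def)
qed

lemma ps_eval_eq_shift_snd:
  assumes "ps_abs_summable r c" "r > 0" "norm x \<le> r" "norm y \<le> r"
  shows "ps_eval c x y = ps_eval c x 0 + y * ps_eval (\<lambda>i j. c i (Suc j)) x y"
proof -
  define term_of where "term_of y = (\<lambda>(i,j). c i j * x ^ i * y ^ j)" for y
  define shift :: "nat \<times> nat \<Rightarrow> nat \<times> nat" where "shift = (\<lambda>(i,j). (i, Suc j))"
  have "inj shift"
    by (auto simp: shift_def inj_on_def)
  have compl: "- range shift = UNIV \<times> {0}"
  proof -
    have "(i, j) \<in> range shift \<longleftrightarrow> j \<noteq> 0" for i j
      by (cases j) (auto simp: shift_def image_def)
    then show ?thesis
      by auto
  qed
  have total: "(term_of y has_sum ps_eval c x y) UNIV" "(term_of 0 has_sum ps_eval c x 0) UNIV"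
    using assms by (auto simp: term_of_def intro!: has_sum_ps_eval[of r])
  have "((\<lambda>(i,j). c i (Suc j) * x ^ i * y ^ j) has_sum ps_eval (\<lambda>i j. c i (Suc j)) x y) UNIV"
    using assms by (intro has_sum_ps_eval[OF ps_abs_summable_shift_snd])
  then have "((\<lambda>p. y * (case p of (i,j) \<Rightarrow> c i (Suc j) * x ^ i * y ^ j))
      has_sum (y * ps_eval (\<lambda>i j. c i (Suc j)) x y)) UNIV"
    by (rule has_sum_cmult_right)
  also have "(\<lambda>p. y * (case p of (i,j) \<Rightarrow> c i (Suc j) * x ^ i * y ^ j)) = term_of y \<circ> shift"
    by (auto simp: fun_eq_iff shift_def term_of_def)
  finally have "(term_of y has_sum (y * ps_eval (\<lambda>i j. c i (Suc j)) x y)) (range shift)"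
    unfolding has_sum_reindex[OF \<open>inj shift\<close>] .
  moreover have "(term_of y has_sum ps_eval c x 0) (- range shift)"
    using total(2) by (subst has_sum_cong_neutral[of UNIV _ "term_of 0" "term_of y"])
      (auto simp: compl term_of_def)
  ultimately have "(term_of y has_sum (y * ps_eval (\<lambda>i j. c i (Suc j)) x y + ps_eval c x 0))
      (range shift \<union> - range shift)"
    by (intro has_sum_Un_disjoint) auto
  with total(1) show ?thesis
    using has_sum_unique by (fastforce simp: Compl_partition add.commute)
qed

lemma holomorphic_germ_divide_snd:
  assumes "holomorphic_germ f"
  obtains g where "holomorphic_germ g" "\<forall>\<^sub>F z in nhds 0. f z = f (fst z, 0) + snd z * g z"
proof -
  obtain c where conv_c: "conv_ps c" and f_eq: "\<forall>\<^sub>F z in nhds 0. f z = ps_eval c (fst z) (snd z)"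
    using osgood[OF assms] .
  obtain r where "r > 0" and summable: "ps_abs_summable r c"
    using conv_c by (auto simp: conv_ps_iff_ps_abs_summable)
  define g where "g z = ps_eval (\<lambda>i j. c i (Suc j)) (fst z) (snd z)" for z
  have "\<forall>\<^sub>F z in nhds (0 :: complex \<times> complex). norm (fst z) < r \<and> norm (snd z) < r"
    using \<open>r > 0\<close> unfolding eventually_nhds_0_iff_polydisc by auto
  moreover have "\<forall>\<^sub>F z in nhds (0 :: complex \<times> complex). f (fst z, 0) = ps_eval c (fst z) 0"
  proof -
    have "filterlim (\<lambda>z. (fst z, 0 :: complex)) (nhds 0) (nhds (0 :: complex \<times> complex))"
      by (intro filterlim_holomorphic_germ_Pair holomorphic_germ_intros) simp_all
    from eventually_compose_filterlim[OF f_eq this] show ?thesis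
      by simp
  qed
  ultimately have "\<forall>\<^sub>F z in nhds 0. f z = f (fst z, 0) + snd z * g z"
    using f_eq
  proof eventually_elim
    case (elim z)
    then show ?case
      using ps_eval_eq_shift_snd[OF summable \<open>r > 0\<close>, of "fst z" "snd z"] by (simp add: g_def)
  qed
  moreover have "conv_ps (\<lambda>i j. c i (Suc j))"
    using ps_abs_summable_shift_snd[OF summable] \<open>r > 0\<close> by (auto simp: conv_ps_iff_ps_abs_summable)
  then have "holomorphic_germ g"
    unfolding g_def by (rule holomorphic_germ_ps_eval)
  ultimately show ?thesis
    using that by blast
qed

lemma holomorphic_germ_divide_graph:
  assumes f: "holomorphic_germ f" and \<gamma>: "\<gamma> analytic_on {0}" "\<gamma> 0 = 0"
    and zero: "\<forall>\<^sub>F x in nhds 0. f (x, - \<gamma> x) = 0"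
  obtains g where "holomorphic_germ g" "\<forall>\<^sub>F z in nhds 0. f z = (snd z + \<gamma> (fst z)) * g z"
proof -
  have \<gamma>_fst: "holomorphic_germ (\<lambda>z. \<gamma> (fst z))"
    using \<gamma>(1) holomorphic_germ_analytic_compose[of \<gamma> fst] holomorphic_germ_fst by simp
  define F where "F z = f (fst z, snd z - \<gamma> (fst z))" for z
  have "holomorphic_germ F"
    unfolding F_def using \<gamma>(2)
    by (intro holomorphic_germ_compose[OF f] holomorphic_germ_intros \<gamma>_fst) auto
  then obtain k where k: "holomorphic_germ k"
    and F_eq: "\<forall>\<^sub>F z in nhds 0. F z = F (fst z, 0) + snd z * k z"
    by (rule holomorphic_germ_divide_snd)
  define shear where "shear z = (fst z, snd z + \<gamma> (fst z))" for z
  have "filterlim shear (nhds 0) (nhds 0)"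
    unfolding shear_def using \<gamma>(2)
    by (intro filterlim_holomorphic_germ_Pair holomorphic_germ_intros \<gamma>_fst) simp_all
  from eventually_compose_filterlim[OF F_eq this]
  have "\<forall>\<^sub>F z in nhds 0. f z = F (fst z, 0) + (snd z + \<gamma> (fst z)) * k (shear z)"
    by (simp add: F_def shear_def)
  moreover have "filterlim fst (nhds 0) (nhds (0 :: complex \<times> complex))"
    using holomorphic_germ_tendsto[OF holomorphic_germ_fst] by simp
  from eventually_compose_filterlim[OF zero this]
  have "\<forall>\<^sub>F z in nhds (0 :: complex \<times> complex). F (fst z, 0) = 0"
    by (simp add: F_def)
  ultimately have "\<forall>\<^sub>F z in nhds 0. f z = (snd z + \<gamma> (fst z)) * k (shear z)"
    by eventually_elim simp
  moreover have "holomorphic_germ (\<lambda>z. k (shear z))"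
    unfolding shear_def using \<gamma>(2)
    by (intro holomorphic_germ_compose[OF k] holomorphic_germ_intros \<gamma>_fst) auto
  ultimately show ?thesis
    using that by blast
qed

section \<open>Orders of vanishing at the origin\<close>

definition vanishes_to_order :: "(complex \<Rightarrow> complex) \<Rightarrow> nat \<Rightarrow> bool" where
  "vanishes_to_order F n \<longleftrightarrow>
     (\<exists>G. G analytic_on {0} \<and> (\<forall>\<^sub>F z in nhds 0. F z = z ^ n * G z))"

definition vanishes_to_exact_order :: "(complex \<Rightarrow> complex) \<Rightarrow> nat \<Rightarrow> bool" where
  "vanishes_to_exact_order F n \<longleftrightarrow>
     (\<exists>G. G analytic_on {0} \<and> G 0 \<noteq> 0 \<and> (\<forall>\<^sub>F z in nhds 0. F z = z ^ n * G z))"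

lemma vanishes_to_order_cong:
  assumes "vanishes_to_order F n" "\<forall>\<^sub>F z in nhds 0. F z = G z"
  shows "vanishes_to_order G n"
proof -
  obtain H where "H analytic_on {0}" "\<forall>\<^sub>F z in nhds 0. F z = z ^ n * H z"
    using assms(1) by (auto simp: vanishes_to_order_def)
  moreover from this(2) assms(2) have "\<forall>\<^sub>F z in nhds 0. G z = z ^ n * H z"
    by eventually_elim simp
  ultimately show ?thesis
    by (auto simp: vanishes_to_order_def)
qed

lemma vanishes_to_order_0: "F analytic_on {0} \<Longrightarrow> vanishes_to_order F 0"
  unfolding vanishes_to_order_def by (intro exI[of _ F]) simp

lemma vanishes_to_order_diff:
  assumes "vanishes_to_order F n" "vanishes_to_order G n"
  shows "vanishes_to_order (\<lambda>z. F z - G z) n"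
proof -
  obtain F' G' where "F' analytic_on {0}" and F_eq: "\<forall>\<^sub>F z in nhds 0. F z = z ^ n * F' z"
    and "G' analytic_on {0}" and G_eq: "\<forall>\<^sub>F z in nhds 0. G z = z ^ n * G' z"
    using assms by (auto simp: vanishes_to_order_def)
  then have "(\<lambda>z. F' z - G' z) analytic_on {0}"
    by (intro analytic_intros)
  moreover have "\<forall>\<^sub>F z in nhds 0. F z - G z = z ^ n * (F' z - G' z)"
    using F_eq G_eq by eventually_elim (simp add: algebra_simps)
  ultimately show ?thesis
    by (auto simp: vanishes_to_order_def intro!: exI[of _ "\<lambda>z. F' z - G' z"])
qed

lemma vanishes_to_order_mult:
  assumes "vanishes_to_order F m" "vanishes_to_order G n"
  shows "vanishes_to_order (\<lambda>z. F z * G z) (m + n)"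
proof -
  obtain F' G' where "F' analytic_on {0}" and F_eq: "\<forall>\<^sub>F z in nhds 0. F z = z ^ m * F' z"
    and "G' analytic_on {0}" and G_eq: "\<forall>\<^sub>F z in nhds 0. G z = z ^ n * G' z"
    using assms by (auto simp: vanishes_to_order_def)
  then have "(\<lambda>z. F' z * G' z) analytic_on {0}"
    by (intro analytic_intros)
  moreover have "\<forall>\<^sub>F z in nhds 0. F z * G z = z ^ (m + n) * (F' z * G' z)"
    using F_eq G_eq by eventually_elim (simp add: power_add)
  ultimately show ?thesis
    by (auto simp: vanishes_to_order_def intro!: exI[of _ "\<lambda>z. F' z * G' z"])
qed

lemma vanishes_to_order_prod:
  "(\<And>k. k \<in> T \<Longrightarrow> vanishes_to_order (F k) (n k)) \<Longrightarrow>
     vanishes_to_order (\<lambda>z. \<Prod>k\<in>T. F k z) (\<Sum>k\<in>T. n k)"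
  by (induction T rule: infinite_finite_induct)
     (auto intro: vanishes_to_order_0 vanishes_to_order_mult)

lemma vanishes_to_exact_order_mult:
  assumes "vanishes_to_exact_order F m" "vanishes_to_exact_order G n"
  shows "vanishes_to_exact_order (\<lambda>z. F z * G z) (m + n)"
proof -
  obtain F' G' where "F' analytic_on {0}" "F' 0 \<noteq> 0" and F_eq: "\<forall>\<^sub>F z in nhds 0. F z = z ^ m * F' z"
    and "G' analytic_on {0}" "G' 0 \<noteq> 0" and G_eq: "\<forall>\<^sub>F z in nhds 0. G z = z ^ n * G' z"
    using assms by (auto simp: vanishes_to_exact_order_def)
  then have "(\<lambda>z. F' z * G' z) analytic_on {0}" "F' 0 * G' 0 \<noteq> 0"
    by (auto intro: analytic_intros)
  moreover have "\<forall>\<^sub>F z in nhds 0. F z * G z = z ^ (m + n) * (F' z * G' z)"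
    using F_eq G_eq by eventually_elim (simp add: power_add)
  ultimately show ?thesis
    by (auto simp: vanishes_to_exact_order_def intro!: exI[of _ "\<lambda>z. F' z * G' z"])
qed

lemma vanishes_to_exact_order_1: "vanishes_to_exact_order (\<lambda>z. 1) 0"
  unfolding vanishes_to_exact_order_def by (intro exI[of _ "\<lambda>z. 1"]) simp

lemma vanishes_to_exact_order_prod:
  "(\<And>k. k \<in> T \<Longrightarrow> vanishes_to_exact_order (F k) (n k)) \<Longrightarrow>
     vanishes_to_exact_order (\<lambda>z. \<Prod>k\<in>T. F k z) (\<Sum>k\<in>T. n k)"
  by (induction T rule: infinite_finite_induct)
     (auto intro: vanishes_to_exact_order_1 vanishes_to_exact_order_mult)

lemma has_fps_expansion_factor_power:
  fixes F :: "complex \<Rightarrow> complex"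
  assumes A: "F has_fps_expansion A" and n: "n \<le> subdegree A"
  obtains G where "G analytic_on {0}" "G 0 = fps_nth A n" "\<forall>\<^sub>F z in nhds 0. F z = z ^ n * G z"
proof -
  define G where "G z = (if z = 0 then fps_nth A n else F z / z ^ n)" for z
  have "G analytic_on {0}"
    using has_fps_expansion_imp_analytic_0[OF has_fps_expansion_shift[OF A n refl]]
    by (simp add: G_def[abs_def])
  moreover have "F 0 = 0 ^ n * fps_nth A n"
  proof (cases "n = 0")
    case False
    then have "fps_nth A 0 = 0"
      using n by (intro nth_less_subdegree_zero) linarith
    then show ?thesis
      using False has_fps_expansion_imp_0_eq_fps_nth_0[OF A] by (simp add: power_0_left)
  qed (simp add: has_fps_expansion_imp_0_eq_fps_nth_0[OF A])
  then have "\<forall>\<^sub>F z in nhds 0. F z = z ^ n * G z"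
    by (intro always_eventually) (auto simp: G_def)
  ultimately show ?thesis
    by (intro that[of G]) (simp_all add: G_def)
qed

lemma vanishes_to_exact_order_if_not_vanishes:
  assumes "F analytic_on {0}" "\<not> vanishes_to_order F v"
  obtains n where "n < v" "vanishes_to_exact_order F n"
proof -
  define A where "A = fps_expansion F 0"
  have A: "F has_fps_expansion A"
    unfolding A_def using assms(1) by (rule analytic_at_imp_has_fps_expansion_0)
  have "A \<noteq> 0"
  proof
    assume "A = 0"
    then have "\<forall>\<^sub>F z in nhds 0. F z = z ^ v * 0"
      using A by (simp add: has_fps_expansion_0_iff)
    then have "vanishes_to_order F v"
      unfolding vanishes_to_order_def by (intro exI[of _ "\<lambda>z. 0"]) simp
    with assms(2) show False ..
  qed
  obtain G where "G analytic_on {0}" "G 0 = fps_nth A (subdegree A)"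
    "\<forall>\<^sub>F z in nhds 0. F z = z ^ subdegree A * G z"
    by (rule has_fps_expansion_factor_power[OF A order_refl])
  with \<open>A \<noteq> 0\<close> have "vanishes_to_exact_order F (subdegree A)"
    by (auto simp: vanishes_to_exact_order_def)
  moreover have "subdegree A < v"
  proof (rule ccontr)
    assume "\<not> subdegree A < v"
    then have "v \<le> subdegree A"
      by simp
    then obtain G where "G analytic_on {0}" "G 0 = fps_nth A v" "\<forall>\<^sub>F z in nhds 0. F z = z ^ v * G z"
      by (rule has_fps_expansion_factor_power[OF A])
    with assms(2) show False
      by (auto simp: vanishes_to_order_def)
  qed
  ultimately show ?thesis
    using that by blast
qed

lemma vanishes_to_order_factor:
  assumes "vanishes_to_order F (m + n)" "vanishes_to_exact_order E m"
  obtains A where "A analytic_on {0}" "\<forall>\<^sub>F z in nhds 0. F z = z ^ n * A z * E z"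
proof -
  obtain G where G: "G analytic_on {0}" and F_eq: "\<forall>\<^sub>F z in nhds 0. F z = z ^ (m + n) * G z"
    using assms(1) by (auto simp: vanishes_to_order_def)
  obtain U where U: "U analytic_on {0}" "U 0 \<noteq> 0" and E_eq: "\<forall>\<^sub>F z in nhds 0. E z = z ^ m * U z"
    using assms(2) by (auto simp: vanishes_to_exact_order_def)
  have "\<forall>\<^sub>F z in nhds 0. U z \<noteq> 0"
    using analytic_at_neq_imp_eventually_neq[OF U] U(2) by (simp add: eventually_nhds_conv_at)
  with F_eq E_eq have "\<forall>\<^sub>F z in nhds 0. F z = z ^ n * (G z / U z) * E z"
    by eventually_elim (simp add: power_add)
  moreover have "(\<lambda>z. G z / U z) analytic_on {0}"
    using G U by (auto intro: analytic_intros)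
  ultimately show ?thesis
    using that by blast
qed

lemma eventually_nhds_eq_if_eventually_at_eq:
  fixes f g :: "complex \<Rightarrow> complex"
  assumes "f analytic_on {w}" "g analytic_on {w}" "\<forall>\<^sub>F z in at w. f z = g z"
  shows "\<forall>\<^sub>F z in nhds w. f z = g z"
proof -
  have "(f \<longlongrightarrow> f w) (at w)" "(g \<longlongrightarrow> g w) (at w)"
    using assms(1,2) analytic_at_imp_isCont isCont_def by blast+
  then have "f w = g w"
    using tendsto_cong[OF assms(3)] tendsto_unique by force
  then show ?thesis
    using assms(3) by (simp add: eventually_nhds_conv_at)
qed

lemma vanishes_to_order_cancel:
  assumes E: "vanishes_to_exact_order E m" and "H analytic_on {0}"
    and "vanishes_to_order (\<lambda>z. E z * H z) (m + n)"
  shows "vanishes_to_order H n"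
proof -
  obtain A where A: "A analytic_on {0}" and EH_eq: "\<forall>\<^sub>F z in nhds 0. E z * H z = z ^ n * A z * E z"
    using vanishes_to_order_factor[OF assms(3) E] by blast
  obtain U where U: "U analytic_on {0}" "U 0 \<noteq> 0" and E_eq: "\<forall>\<^sub>F z in nhds 0. E z = z ^ m * U z"
    using E by (auto simp: vanishes_to_exact_order_def)
  have "\<forall>\<^sub>F z in at 0. U z \<noteq> 0" "\<forall>\<^sub>F z in at 0. z \<noteq> (0 :: complex)"
    by (rule analytic_at_neq_imp_eventually_neq[OF U]) (simp add: eventually_at_filter)
  moreover have "\<forall>\<^sub>F z in at 0. E z * H z = z ^ n * A z * E z \<and> E z = z ^ m * U z"
    using EH_eq E_eq by (simp add: eventually_nhds_conv_at eventually_conj_iff)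
  ultimately have "\<forall>\<^sub>F z in at 0. H z = z ^ n * A z"
    by eventually_elim auto
  then have "\<forall>\<^sub>F z in nhds 0. H z = z ^ n * A z"
    by (intro eventually_nhds_eq_if_eventually_at_eq analytic_intros A assms(2))
  with A show ?thesis
    by (auto simp: vanishes_to_order_def)
qed

lemma analytic_on_poly [analytic_intros]: "poly p analytic_on S"
  by (rule analytic_on_subset[of _ UNIV]) (auto simp: analytic_on_open intro: holomorphic_intros)

lemma vanishes_to_order_poly:
  assumes "monom 1 n dvd p"
  shows "vanishes_to_order (poly p) n"
proof -
  obtain r where "p = monom 1 n * r"
    using assms by blast
  then show ?thesis
    unfolding vanishes_to_order_def
    by (intro exI[of _ "poly r"]) (simp add: poly_monom analytic_on_poly)
qed

lemma vanishes_to_exact_order_poly: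
  assumes "monom 1 n dvd p" "coeff p n \<noteq> 0"
  shows "vanishes_to_exact_order (poly p) n"
proof -
  obtain r where "p = monom 1 n * r"
    using assms by blast
  moreover from this have "poly r 0 \<noteq> 0"
    using assms(2) by (simp add: coeff_monom_mult poly_0_coeff_0)
  ultimately show ?thesis
    unfolding vanishes_to_exact_order_def
    by (intro exI[of _ "poly r"]) (simp add: poly_monom analytic_on_poly)
qed

lemma vanishes_to_order_Suc_iff:
  assumes "G analytic_on {0}" and F_eq: "\<forall>\<^sub>F z in nhds 0. F z = F 0 + z * G z"
  shows "vanishes_to_order F (Suc v) \<longleftrightarrow> F 0 = 0 \<and> vanishes_to_order G v"
proof
  assume vanishes: "vanishes_to_order F (Suc v)"
  then obtain H where "\<forall>\<^sub>F z in nhds 0. F z = z ^ Suc v * H z"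
    by (auto simp: vanishes_to_order_def)
  then have "F 0 = 0"
    using eventually_nhds_x_imp_x by fastforce
  with F_eq have "\<forall>\<^sub>F z in nhds 0. F z = z * G z"
    by simp
  from vanishes_to_order_cong[OF vanishes this]
  have "vanishes_to_order (\<lambda>z. z * G z) (1 + v)"
    by simp
  moreover have "vanishes_to_exact_order (\<lambda>z. z) 1"
    unfolding vanishes_to_exact_order_def by (intro exI[of _ "\<lambda>z. 1"]) simp
  ultimately show "F 0 = 0 \<and> vanishes_to_order G v"
    using \<open>F 0 = 0\<close> assms(1) vanishes_to_order_cancel by blast
next
  assume vanishes: "F 0 = 0 \<and> vanishes_to_order G v"
  then obtain H where "H analytic_on {0}" and G_eq: "\<forall>\<^sub>F z in nhds 0. G z = z ^ v * H z"
    by (auto simp: vanishes_to_order_def)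
  moreover from F_eq G_eq have "\<forall>\<^sub>F z in nhds 0. F z = z ^ Suc v * H z"
    by eventually_elim (use vanishes in simp)
  ultimately show "vanishes_to_order F (Suc v)"
    by (auto simp: vanishes_to_order_def)
qed

lemma holomorphic_germ_eventually_analytic_snd:
  assumes "holomorphic_germ f"
  shows "\<forall>\<^sub>F s in nhds 0. (\<lambda>z. f (s, z)) analytic_on {0}"
proof -
  obtain r B where "0 < r" and f: "f jointly_holomorphic_on ball 0 r \<times> ball 0 r"
    using holomorphic_germ_bounded_polydisc[OF assms] by metis
  then have "(\<lambda>z. f (s, z)) analytic_on {0}" if "s \<in> ball 0 r" for s
    using that holomorphic_on_slices(2)[OF f open_ball open_ball]
    by (intro holomorphic_on_imp_analytic_at[of _ "ball 0 r"]) auto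
  then show ?thesis
    using \<open>0 < r\<close> by (auto intro!: eventually_mono[OF eventually_nhds_in_open[of "ball 0 r" 0]])
qed

lemma eventually_nhds_0_Pair:
  fixes Q :: "'a :: real_normed_vector \<times> 'b :: real_normed_vector \<Rightarrow> bool"
  assumes "\<forall>\<^sub>F z in nhds 0. Q z"
  shows "\<forall>\<^sub>F s in nhds 0. \<forall>\<^sub>F z in nhds 0. Q (s, z)"
proof -
  obtain e where "e > 0" and "\<And>s z. norm s < e \<Longrightarrow> norm z < e \<Longrightarrow> Q (s, z)"
    using assms by (auto simp: eventually_nhds_0_iff_polydisc)
  then show ?thesis
    by (fastforce simp: eventually_nhds_metric)
qed

text \<open>Vanishing to order \<open>v\<close> is a closed condition in a parameter \<open>s\<close>: dividing by \<open>z\<close> lowers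
  \<open>v\<close>, and for \<open>v = 1\<close> this is continuity.\<close>
lemma vanishes_to_order_closed:
  assumes "holomorphic_germ f" "\<exists>\<^sub>F s in nhds 0. vanishes_to_order (\<lambda>z. f (s, z)) v"
  shows "vanishes_to_order (\<lambda>z. f (0, z)) v"
  using assms
proof (induction v arbitrary: f)
  case 0
  have "(\<lambda>z. f (0, z)) analytic_on {0}"
    using holomorphic_germ_eventually_analytic_snd[OF 0(1)] by (rule eventually_nhds_x_imp_x)
  then show ?case
    by (rule vanishes_to_order_0)
next
  case (Suc v)
  obtain g where g: "holomorphic_germ g"
    and f_eq: "\<forall>\<^sub>F z in nhds 0. f z = f (fst z, 0) + snd z * g z"
    by (rule holomorphic_germ_divide_snd[OF Suc.prems(1)])
  have "\<forall>\<^sub>F s in nhds 0. \<forall>\<^sub>F z in nhds 0. f (s, z) = f (s, 0) + z * g (s, z)"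
    using eventually_nhds_0_Pair[OF f_eq] by simp
  with holomorphic_germ_eventually_analytic_snd[OF g]
  have Suc_iff: "\<forall>\<^sub>F s in nhds 0. vanishes_to_order (\<lambda>z. f (s, z)) (Suc v) \<longleftrightarrow>
      f (s, 0) = 0 \<and> vanishes_to_order (\<lambda>z. g (s, z)) v"
    by eventually_elim (rule vanishes_to_order_Suc_iff)
  then have "\<exists>\<^sub>F s in nhds 0. f (s, 0) = 0 \<and> vanishes_to_order (\<lambda>z. g (s, z)) v"
    by (intro frequently_rev_mp[OF Suc.prems(2)]) (auto elim: eventually_mono)
  then have f_zero: "\<exists>\<^sub>F s in nhds 0. f (s, 0) = 0"
    and "\<exists>\<^sub>F s in nhds 0. vanishes_to_order (\<lambda>z. g (s, z)) v"
    by (auto elim: frequently_elim1)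
  then have "vanishes_to_order (\<lambda>z. g (0, z)) v"
    by (intro Suc.IH g)
  moreover have "((\<lambda>s. f (s, 0)) \<longlongrightarrow> f (0, 0)) (nhds 0)"
  proof -
    have "filterlim (\<lambda>s. (s, 0 :: complex)) (nhds 0) (nhds (0 :: complex))"
      using tendsto_Pair[OF filterlim_ident tendsto_const, of "0 :: complex" "0 :: complex"]
      by (simp add: zero_prod_def)
    from filterlim_compose[OF holomorphic_germ_tendsto[OF Suc.prems(1)] this] show ?thesis
      by (simp add: zero_prod_def)
  qed
  then have "f (0, 0) = 0"
    using f_zero tendsto_imp_eventually_ne[of "\<lambda>s. f (s, 0)" "f (0, 0)" "nhds 0" 0]
    by (auto simp: frequently_def)
  ultimately show ?case
    using eventually_nhds_x_imp_x[OF Suc_iff] by simp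
qed

section \<open>Restriction to graphs of real polynomials\<close>

abbreviation (input) complex_poly :: "real poly \<Rightarrow> complex poly" where
  "complex_poly \<equiv> map_poly of_real"

lemma poly_complex_poly [simp]: "poly (complex_poly p) (of_real x) = of_real (poly p x)"
  by (induction p) (auto simp: map_poly_pCons)

lemma complex_poly_add [simp]: "complex_poly (p + r) = complex_poly p + complex_poly r"
  by (rule poly_eqI) (simp add: coeff_map_poly)

lemma complex_poly_uminus [simp]: "complex_poly (- p) = - complex_poly p"
  by (rule poly_eqI) (simp add: coeff_map_poly)

definition restrict_graph :: "real poly \<Rightarrow> (complex \<times> complex \<Rightarrow> complex) \<Rightarrow> complex \<Rightarrow> complex" where
  "restrict_graph c f z = f (z, poly (complex_poly c) z)"

lemma poly_complex_poly_0: "poly c 0 = 0 \<Longrightarrow> poly (complex_poly c) 0 = 0"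
  using poly_complex_poly[of c 0] by simp

lemma analytic_on_restrict_graph:
  assumes "holomorphic_germ f" "poly c 0 = 0"
  shows "restrict_graph c f analytic_on {0}"
  unfolding restrict_graph_def[abs_def]
  using assms(2) by (intro analytic_on_holomorphic_germ_curve[OF assms(1)] analytic_intros)
    (simp_all add: poly_complex_poly_0)

lemma eventually_restrict_graph:
  assumes "\<forall>\<^sub>F z in nhds 0. Q z" "poly c 0 = 0"
  shows "\<forall>\<^sub>F z in nhds 0. Q (z, poly (complex_poly c) z)"
proof -
  have "isCont (poly (complex_poly c)) 0"
    by simp
  then have "filterlim (\<lambda>z. (z, poly (complex_poly c) z)) (nhds 0) (nhds 0)"
    using assms(2) unfolding isCont_def tendsto_at_iff_tendsto_nhds
    by (auto simp: zero_prod_def poly_complex_poly_0 intro: tendsto_Pair filterlim_ident)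
  from eventually_compose_filterlim[OF assms(1) this] show ?thesis .
qed

lemma vanishes_to_order_limit_graph:
  assumes f: "holomorphic_germ f" and "poly c 0 = 0"
    and freq: "\<exists>\<^sub>F s in at 0. vanishes_to_order (restrict_graph (c + monom s n) f) v"
  shows "vanishes_to_order (restrict_graph c f) v"
proof -
  define g where "g z = f (snd z, poly (complex_poly c) (snd z) + fst z * snd z ^ n)" for z
  have "holomorphic_germ g"
    unfolding g_def using assms(2)
    by (intro holomorphic_germ_compose[OF f] holomorphic_germ_intros)
       (simp_all add: poly_complex_poly_0)
  moreover have g_eq: "restrict_graph (c + monom s n) f = (\<lambda>z. g (of_real s, z))" for s
    by (simp add: fun_eq_iff restrict_graph_def g_def map_poly_monom poly_monom)
  have "\<exists>\<^sub>F s in nhds 0. vanishes_to_order (\<lambda>z. g (s, z)) v"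
  proof (rule ccontr)
    assume "\<not> ?thesis"
    then have "\<forall>\<^sub>F s in nhds 0. \<not> vanishes_to_order (\<lambda>z. g (s, z)) v"
      by (simp add: not_frequently)
    moreover have "((\<lambda>s. complex_of_real s) \<longlongrightarrow> of_real 0) (at 0)"
      by (intro tendsto_intros)
    ultimately have "\<forall>\<^sub>F s in at 0. \<not> vanishes_to_order (\<lambda>z. g (complex_of_real s, z)) v"
      by (intro eventually_compose_filterlim[where f = complex_of_real]) auto
    with freq show False
      by (simp add: frequently_def g_eq)
  qed
  ultimately have "vanishes_to_order (\<lambda>z. g (0, z)) v"
    by (rule vanishes_to_order_closed)
  then show ?thesis
    by (simp add: g_def restrict_graph_def[abs_def])
qed

section \<open>Products of ideals with two generators\<close>

definition product_generator ::
  "('i \<Rightarrow> complex \<times> complex \<Rightarrow> complex) \<Rightarrow> ('i \<Rightarrow> complex \<times> complex \<Rightarrow> complex)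
     \<Rightarrow> 'i set \<Rightarrow> 'i set \<Rightarrow> complex \<times> complex \<Rightarrow> complex" where
  "product_generator a b T S z = (\<Prod>j\<in>T. if j \<in> S then a j z else b j z)"

definition in_ideal_product ::
  "('i \<Rightarrow> complex \<times> complex \<Rightarrow> complex) \<Rightarrow> ('i \<Rightarrow> complex \<times> complex \<Rightarrow> complex)
     \<Rightarrow> 'i set \<Rightarrow> (complex \<times> complex \<Rightarrow> complex) \<Rightarrow> bool" where
  "in_ideal_product a b T f \<longleftrightarrow> (\<exists>h. (\<forall>S. holomorphic_germ (h S)) \<and>
     (\<forall>\<^sub>F z in nhds 0. f z = (\<Sum>S\<in>Pow T. h S z * product_generator a b T S z)))"

lemma in_ideal_product_empty:
  assumes "holomorphic_germ f"
  shows "in_ideal_product a b {} f"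
  unfolding in_ideal_product_def using assms
  by (intro exI[of _ "\<lambda>_. f"]) (simp add: product_generator_def)

lemma in_ideal_product_generator:
  assumes "finite T" "S \<subseteq> T" "holomorphic_germ \<alpha>"
  shows "in_ideal_product a b T (\<lambda>z. \<alpha> z * product_generator a b T S z)"
proof -
  define h where "h S' z = (if S' = S then \<alpha> z else 0)" for S' z
  have "holomorphic_germ (h S')" for S'
    using assms(3) by (cases "S' = S") (simp_all add: h_def[abs_def] holomorphic_germ_const)
  moreover have "\<alpha> z * product_generator a b T S z
      = (\<Sum>S'\<in>Pow T. h S' z * product_generator a b T S' z)" for z
    using assms(1,2) by (simp add: h_def if_distrib[of "\<lambda>u. u * _"] cong: if_cong)
  ultimately show ?thesis
    unfolding in_ideal_product_def by (intro exI[of _ h]) simp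
qed

lemma product_generator_insert:
  assumes "finite T" "j \<notin> T" "S \<subseteq> T"
  shows "product_generator a b (insert j T) (insert j S) z = a j z * product_generator a b T S z"
    and "product_generator a b (insert j T) S z = b j z * product_generator a b T S z"
proof -
  have "(\<Prod>k\<in>T. if k \<in> insert j S then a k z else b k z) = (\<Prod>k\<in>T. if k \<in> S then a k z else b k z)"
    using assms(2) by (intro prod.cong) auto
  then show "product_generator a b (insert j T) (insert j S) z =
      a j z * product_generator a b T S z"
    using assms(1,2) by (simp add: product_generator_def)
  show "product_generator a b (insert j T) S z = b j z * product_generator a b T S z"
    using assms by (auto simp: product_generator_def)
qed

lemma sum_Pow_insert:
  assumes "finite T" "j \<notin> T"
  shows "(\<Sum>S\<in>Pow (insert j T). u S) = (\<Sum>S\<in>Pow T. u (insert j S)) + (\<Sum>S\<in>Pow T. u S)"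
proof -
  have "inj_on (insert j) (Pow T)"
    by (rule inj_on_inverseI[of _ "\<lambda>S. S - {j}"]) (use assms(2) in auto)
  moreover have "Pow T \<inter> insert j ` Pow T = {}"
    using assms(2) by auto
  ultimately show ?thesis
    using assms(1) by (simp add: Pow_insert sum.union_disjoint sum.reindex add.commute)
qed

lemma in_ideal_product_insert:
  assumes T: "finite T" "j \<notin> T"
    and "in_ideal_product a b T g" "in_ideal_product a b T h"
    and f_eq: "\<forall>\<^sub>F z in nhds 0. f z = a j z * g z + b j z * h z"
  shows "in_ideal_product a b (insert j T) f"
proof -
  obtain G where G: "\<And>S. holomorphic_germ (G S)"
    and g_eq: "\<forall>\<^sub>F z in nhds 0. g z = (\<Sum>S\<in>Pow T. G S z * product_generator a b T S z)"
    using assms(3) by (auto simp: in_ideal_product_def)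
  obtain H where H: "\<And>S. holomorphic_germ (H S)"
    and h_eq: "\<forall>\<^sub>F z in nhds 0. h z = (\<Sum>S\<in>Pow T. H S z * product_generator a b T S z)"
    using assms(4) by (auto simp: in_ideal_product_def)
  define F where "F S = (if j \<in> S then G (S - {j}) else H S)" for S
  have sum_eq: "(\<Sum>S\<in>Pow (insert j T). F S z * product_generator a b (insert j T) S z)
      = a j z * (\<Sum>S\<in>Pow T. G S z * product_generator a b T S z)
        + b j z * (\<Sum>S\<in>Pow T. H S z * product_generator a b T S z)" for z
  proof -
    have "F (insert j S) = G S" "F S = H S" if "S \<subseteq> T" for S
      using that T(2) by (auto simp: F_def intro!: arg_cong[of _ _ G])
    then show ?thesis
      unfolding sum_Pow_insert[OF T] sum_distrib_left
      by (intro arg_cong2[of _ _ _ _ "(+)"] sum.cong) (simp_all add: product_generator_insert[OF T])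
  qed
  have "\<forall>\<^sub>F z in nhds 0.
      f z = (\<Sum>S\<in>Pow (insert j T). F S z * product_generator a b (insert j T) S z)"
    using f_eq g_eq h_eq by eventually_elim (simp add: sum_eq)
  moreover have "holomorphic_germ (F S)" for S
    using G H by (simp add: F_def)
  ultimately show ?thesis
    unfolding in_ideal_product_def by blast
qed

lemma prod_ideal_iff_in_ideal_product:
  "Q \<in> prod_ideal M a b \<longleftrightarrow> conv_ps Q \<and>
     in_ideal_product (\<lambda>j z. a j (fst z) (snd z)) (\<lambda>j z. b j (fst z) (snd z)) {..<M}
       (\<lambda>z. ps_eval Q (fst z) (snd z))"
  (is "_ \<longleftrightarrow> _ \<and> ?product")
proof -
  define gen where
    "gen S z = (\<Prod>j<M. if j \<in> S then a j (fst z) (snd z) else b j (fst z) (snd z))" for S z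
  have "?product \<longleftrightarrow> (\<exists>c. (\<forall>S. conv_ps (c S)) \<and>
      (\<forall>\<^sub>F z in nhds 0. ps_eval Q (fst z) (snd z) =
         (\<Sum>S\<in>Pow {..<M}. ps_eval (c S) (fst z) (snd z) * gen S z)))"
    (is "_ \<longleftrightarrow> ?series")
  proof
    assume ?product
    then obtain h where h: "\<And>S. holomorphic_germ (h S)"
      and Q_eq: "\<forall>\<^sub>F z in nhds 0. ps_eval Q (fst z) (snd z) = (\<Sum>S\<in>Pow {..<M}. h S z * gen S z)"
      by (auto simp: in_ideal_product_def product_generator_def gen_def)
    have "\<forall>S. \<exists>c. conv_ps c \<and> (\<forall>\<^sub>F z in nhds 0. h S z = ps_eval c (fst z) (snd z))"
      using osgood[OF h] by metis
    then obtain c where conv_c: "\<And>S. conv_ps (c S)"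
      and h_eq: "\<And>S. \<forall>\<^sub>F z in nhds 0. h S z = ps_eval (c S) (fst z) (snd z)"
      by metis
    have "\<forall>\<^sub>F z in nhds 0. \<forall>S\<in>Pow {..<M}. h S z = ps_eval (c S) (fst z) (snd z)"
      using h_eq by (intro eventually_ball_finite) auto
    with Q_eq have "\<forall>\<^sub>F z in nhds 0. ps_eval Q (fst z) (snd z) =
        (\<Sum>S\<in>Pow {..<M}. ps_eval (c S) (fst z) (snd z) * gen S z)"
      by eventually_elim (auto intro!: sum.cong)
    with conv_c show ?series
      by blast
  next
    assume ?series
    then obtain c where "\<And>S. conv_ps (c S)" and Q_eq: "\<forall>\<^sub>F z in nhds 0. ps_eval Q (fst z) (snd z) =
        (\<Sum>S\<in>Pow {..<M}. ps_eval (c S) (fst z) (snd z) * gen S z)"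
      by blast
    then show ?product
      unfolding in_ideal_product_def product_generator_def gen_def
      by (intro exI[of _ "\<lambda>S z. ps_eval (c S) (fst z) (snd z)"])
         (simp add: holomorphic_germ_ps_eval)
  qed
  then show ?thesis
    by (simp add: prod_ideal_def eventually_nhds_0_iff_polydisc gen_def cong: if_cong)
qed

section \<open>Order of the bracket along a graph\<close>

definition truncated_order :: "nat \<Rightarrow> real poly \<Rightarrow> nat" where
  "truncated_order m r = (if r = 0 then m else min m (order 0 r))"

lemma le_truncated_order_iff: "k \<le> truncated_order m r \<longleftrightarrow> k \<le> m \<and> monom 1 k dvd r"
  by (simp add: truncated_order_def monom_1_dvd_iff)

lemma truncated_order_add_monom:
  assumes "m \<le> n"
  shows "truncated_order m (r + monom s n) = truncated_order m r"
proof -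
  have "monom 1 k dvd r + monom s n \<longleftrightarrow> monom 1 k dvd r" if "k \<le> m" for k
    using that assms by (auto simp: monom_1_dvd_iff')
  then have "k \<le> truncated_order m (r + monom s n) \<longleftrightarrow> k \<le> truncated_order m r" for k
    by (auto simp: le_truncated_order_iff)
  then show ?thesis
    by (meson order_antisym order_refl)
qed

lemma truncated_order_le: "truncated_order m r \<le> m"
  and monom_truncated_order_dvd: "monom 1 (truncated_order m r) dvd r"
  using le_truncated_order_iff[of "truncated_order m r" m r] by simp_all

lemma coeff_truncated_order_nonzero_if_less:
  assumes "truncated_order m r < m"
  shows "coeff r (truncated_order m r) \<noteq> 0"
proof
  assume "coeff r (truncated_order m r) = 0"
  then have "monom 1 (Suc (truncated_order m r)) dvd r"
    using monom_truncated_order_dvd[of m r] by (auto simp: monom_1_dvd_iff' less_Suc_eq)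
  then show False
    using assms le_truncated_order_iff[of "Suc (truncated_order m r)" m r] by simp
qed

lemma coeff_truncated_order_nonzero:
  assumes "i \<le> m" "coeff r i \<noteq> 0"
  shows "coeff r (truncated_order m r) \<noteq> 0"
proof (cases "truncated_order m r < m")
  case False
  then have "truncated_order m r = m" "monom 1 m dvd r"
    using truncated_order_le[of m r] monom_truncated_order_dvd[of m r] by simp_all
  with assms show ?thesis
    by (auto simp: monom_1_dvd_iff' order_le_less)
qed (rule coeff_truncated_order_nonzero_if_less)

definition branch :: "('i \<Rightarrow> real poly) \<Rightarrow> 'i \<Rightarrow> complex \<times> complex \<Rightarrow> complex" where
  "branch q j z = snd z + poly (complex_poly (q j)) (fst z)"

definition bracket ::
  "('i \<Rightarrow> real poly) \<Rightarrow> ('i \<Rightarrow> nat) \<Rightarrow> 'i set \<Rightarrow> complex \<times> complex \<Rightarrow> complex" where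
  "bracket q m T z = (\<Prod>k\<in>T. branch q k z + \<i> * fst z ^ m k)"

definition bracket_order ::
  "('i \<Rightarrow> real poly) \<Rightarrow> ('i \<Rightarrow> nat) \<Rightarrow> 'i set \<Rightarrow> real poly \<Rightarrow> nat" where
  "bracket_order q m T c = (\<Sum>k\<in>T. truncated_order (m k) (c + q k))"

lemma bracket_order_insert:
  "finite T \<Longrightarrow> j \<notin> T \<Longrightarrow>
     bracket_order q m (insert j T) c = truncated_order (m j) (c + q j) + bracket_order q m T c"
  by (simp add: bracket_order_def)

lemma bracket_order_add_monom:
  assumes "\<And>k. k \<in> T \<Longrightarrow> m k \<le> n"
  shows "bracket_order q m T (c + monom s n) = bracket_order q m T c"
  unfolding bracket_order_def
proof (rule sum.cong[OF refl])
  fix k assume "k \<in> T"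
  then show "truncated_order (m k) (c + monom s n + q k) = truncated_order (m k) (c + q k)"
    using truncated_order_add_monom[OF assms, of k "c + q k" s] by (simp add: add_ac)
qed

abbreviation (input) bracket_generator ::
  "('i \<Rightarrow> real poly) \<Rightarrow> ('i \<Rightarrow> nat) \<Rightarrow> 'i set \<Rightarrow> 'i set \<Rightarrow> complex \<times> complex \<Rightarrow> complex" where
  "bracket_generator q m \<equiv> product_generator (branch q) (\<lambda>j z. fst z ^ m j)"

abbreviation (input) in_bracket_ideal ::
  "('i \<Rightarrow> real poly) \<Rightarrow> ('i \<Rightarrow> nat) \<Rightarrow> 'i set \<Rightarrow> (complex \<times> complex \<Rightarrow> complex) \<Rightarrow> bool" where
  "in_bracket_ideal q m \<equiv> in_ideal_product (branch q) (\<lambda>j z. fst z ^ m j)"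

lemma restrict_graph_branch: "restrict_graph c (branch q j) = poly (complex_poly (c + q j))"
  by (simp add: fun_eq_iff restrict_graph_def branch_def)

lemma monom_dvd_complex_poly_iff: "monom 1 n dvd complex_poly r \<longleftrightarrow> monom 1 n dvd r"
  by (simp add: monom_1_dvd_iff' coeff_map_poly)

lemma vanishes_to_exact_order_bracket:
  "vanishes_to_exact_order (restrict_graph c (bracket q m T)) (bracket_order q m T c)"
proof -
  define r where "r k = c + q k" for k
  define factor where "factor k = complex_poly (r k) + monom \<i> (m k)" for k
  have "restrict_graph c (bracket q m T) = (\<lambda>z. \<Prod>k\<in>T. poly (factor k) z)"
    by (auto simp: fun_eq_iff restrict_graph_def bracket_def branch_def factor_def r_def poly_monom
        intro!: prod.cong)
  moreover have "vanishes_to_exact_order (poly (factor k)) (truncated_order (m k) (r k))" for k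
  proof (rule vanishes_to_exact_order_poly)
    show "monom 1 (truncated_order (m k) (r k)) dvd factor k"
      using truncated_order_le[of "m k" "r k"] monom_truncated_order_dvd[of "m k" "r k"]
      by (simp add: factor_def monom_1_dvd_iff' coeff_map_poly)
    show "coeff (factor k) (truncated_order (m k) (r k)) \<noteq> 0"
    proof (cases "truncated_order (m k) (r k) < m k")
      case True
      then show ?thesis
        using coeff_truncated_order_nonzero_if_less[OF True]
        by (simp add: factor_def coeff_map_poly)
    next
      case False
      then show ?thesis
        using truncated_order_le[of "m k" "r k"]
        by (simp add: factor_def coeff_map_poly complex_eq_iff)
    qed
  qed
  ultimately show ?thesis
    using vanishes_to_exact_order_prod[of T "\<lambda>k. poly (factor k)" "\<lambda>k. truncated_order (m k) (r k)"]
    by (simp add: bracket_order_def r_def)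
qed

lemma restrict_graph_bracket_generator:
  "restrict_graph c (bracket_generator q m T S) =
     (\<lambda>z. \<Prod>k\<in>T. poly (if k \<in> S then complex_poly (c + q k) else monom 1 (m k)) z)"
  by (auto simp: fun_eq_iff restrict_graph_def product_generator_def branch_def poly_monom
      intro!: prod.cong)

lemma monom_truncated_order_dvd_generator_factor:
  "monom 1 (truncated_order m r) dvd (if b then complex_poly r else monom 1 m)"
  using monom_truncated_order_dvd[of m r] truncated_order_le[of m r]
  by (simp add: monom_dvd_complex_poly_iff) (simp add: monom_1_dvd_iff')

lemma vanishes_to_order_bracket_generator:
  "vanishes_to_order (restrict_graph c (bracket_generator q m T S)) (bracket_order q m T c)"
  unfolding restrict_graph_bracket_generator bracket_order_def
  by (intro vanishes_to_order_prod vanishes_to_order_poly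
      monom_truncated_order_dvd_generator_factor)

lemma vanishes_to_order_mult_bracket_generator:
  assumes "holomorphic_germ \<alpha>" "poly c 0 = 0"
  shows "vanishes_to_order (restrict_graph c (\<lambda>z. \<alpha> z * bracket_generator q m T S z))
    (bracket_order q m T c)"
proof -
  have "vanishes_to_order (restrict_graph c \<alpha>) 0"
    using assms by (intro vanishes_to_order_0 analytic_on_restrict_graph)
  from vanishes_to_order_mult[OF this vanishes_to_order_bracket_generator[of c q m T S]]
  show ?thesis
    by (simp add: restrict_graph_def[abs_def])
qed

lemma exact_order_bracket_generator:
  obtains S where "S \<subseteq> T"
    "vanishes_to_exact_order (restrict_graph c (bracket_generator q m T S)) (bracket_order q m T c)"
proof
  define r where "r k = c + q k" for k
  define S where "S = {k \<in> T. truncated_order (m k) (r k) < m k}"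
  show "S \<subseteq> T"
    by (auto simp: S_def)
  have "coeff (if k \<in> S then complex_poly (r k) else monom 1 (m k))
      (truncated_order (m k) (r k)) \<noteq> 0" if "k \<in> T" for k
    using truncated_order_le[of "m k" "r k"] coeff_truncated_order_nonzero_if_less[of "m k" "r k"]
      that by (auto simp: S_def coeff_map_poly)
  then show "vanishes_to_exact_order (restrict_graph c (bracket_generator q m T S))
      (bracket_order q m T c)"
    unfolding restrict_graph_bracket_generator bracket_order_def r_def[symmetric]
    by (intro vanishes_to_exact_order_prod vanishes_to_exact_order_poly
        monom_truncated_order_dvd_generator_factor) auto
qed

lemma holomorphic_germ_bracket_generator: "holomorphic_germ (bracket_generator q m T S)"
proof -
  have "holomorphic_germ (\<lambda>z. if k \<in> S then branch q k z else fst z ^ m k)" for k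
    by (cases "k \<in> S") (auto simp: branch_def intro!: holomorphic_germ_intros)
  then show ?thesis
    unfolding product_generator_def[abs_def] by (intro holomorphic_germ_prod)
qed

section \<open>Membership from vanishing along graphs near the branches\<close>

lemma branch_decomposition:
  assumes f: "holomorphic_germ f" and "poly (q j) 0 = 0"
    and "vanishes_to_order (restrict_graph (- q j) f) (bracket_order q m T (- q j) + m j)"
  obtains S \<alpha> g where "S \<subseteq> T" "holomorphic_germ \<alpha>" "holomorphic_germ g"
    "\<forall>\<^sub>F z in nhds 0. f z = branch q j z * g z + fst z ^ m j * (\<alpha> z * bracket_generator q m T S z)"
proof -
  obtain S where S: "S \<subseteq> T"
    and exact: "vanishes_to_exact_order (restrict_graph (- q j) (bracket_generator q m T S))
      (bracket_order q m T (- q j))"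
    by (rule exact_order_bracket_generator)
  obtain \<alpha> where \<alpha>: "\<alpha> analytic_on {0}"
    and on_branch: "\<forall>\<^sub>F z in nhds 0. restrict_graph (- q j) f z =
      z ^ m j * \<alpha> z * restrict_graph (- q j) (bracket_generator q m T S) z"
    by (rule vanishes_to_order_factor[OF assms(3) exact])
  have \<alpha>_fst: "holomorphic_germ (\<lambda>z. \<alpha> (fst z))"
    using holomorphic_germ_analytic_compose[of \<alpha> fst] \<alpha> holomorphic_germ_fst by simp
  define r where "r z = fst z ^ m j * (\<alpha> (fst z) * bracket_generator q m T S z)" for z
  have "holomorphic_germ (\<lambda>z. f z - r z)"
    unfolding r_def
    by (intro holomorphic_germ_diff holomorphic_germ_mult holomorphic_germ_power
        holomorphic_germ_fst holomorphic_germ_bracket_generator f \<alpha>_fst)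
  moreover have "\<forall>\<^sub>F x in nhds 0.
      f (x, - poly (complex_poly (q j)) x) - r (x, - poly (complex_poly (q j)) x) = 0"
    using on_branch by eventually_elim (simp add: restrict_graph_def r_def mult.assoc)
  ultimately obtain g where "holomorphic_germ g" "\<forall>\<^sub>F z in nhds 0. f z - r z = branch q j z * g z"
    using holomorphic_germ_divide_graph[of "\<lambda>z. f z - r z" "poly (complex_poly (q j))"] assms(2)
    unfolding branch_def by (auto simp: analytic_on_poly poly_complex_poly_0)
  moreover from this(2) have "\<forall>\<^sub>F z in nhds 0. f z = branch q j z * g z + r z"
    by eventually_elim (simp add: algebra_simps)
  ultimately show ?thesis
    using that[OF S \<alpha>_fst] unfolding r_def by blast
qed

lemma vanishes_to_order_branch_quotient:
  assumes "finite T" "j \<notin> T" "holomorphic_germ g" "poly c 0 = 0"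
    and "i \<le> m j" "coeff (c + q j) i \<noteq> 0"
    and "vanishes_to_order (restrict_graph c f) (bracket_order q m (insert j T) c)"
    and "vanishes_to_order (restrict_graph c r) (bracket_order q m (insert j T) c)"
    and "\<forall>\<^sub>F z in nhds 0. f z = branch q j z * g z + r z"
  shows "vanishes_to_order (restrict_graph c g) (bracket_order q m T c)"
proof (rule vanishes_to_order_cancel)
  show "vanishes_to_exact_order (restrict_graph c (branch q j)) (truncated_order (m j) (c + q j))"
    unfolding restrict_graph_branch
  proof (rule vanishes_to_exact_order_poly)
    show "monom 1 (truncated_order (m j) (c + q j)) dvd complex_poly (c + q j)"
      unfolding monom_dvd_complex_poly_iff by (rule monom_truncated_order_dvd)
    show "coeff (complex_poly (c + q j)) (truncated_order (m j) (c + q j)) \<noteq> 0"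
      using coeff_truncated_order_nonzero[OF assms(5,6)]
      by (simp add: coeff_map_poly flip: of_real_add)
  qed
  show "restrict_graph c g analytic_on {0}"
    using assms(3,4) by (rule analytic_on_restrict_graph)
  have "\<forall>\<^sub>F z in nhds 0. restrict_graph c f z - restrict_graph c r z
      = restrict_graph c (branch q j) z * restrict_graph c g z"
    using eventually_restrict_graph[OF assms(9,4)]
    by eventually_elim (simp add: restrict_graph_def)
  from vanishes_to_order_cong[OF vanishes_to_order_diff[OF assms(7,8)] this]
  show "vanishes_to_order (\<lambda>z. restrict_graph c (branch q j) z * restrict_graph c g z)
      (truncated_order (m j) (c + q j) + bracket_order q m T c)"
    using assms(1,2) by (simp add: bracket_order_insert)
qed

definition vanishes_near_branches ::
  "('i \<Rightarrow> real poly) \<Rightarrow> ('i \<Rightarrow> nat) \<Rightarrow> 'i set \<Rightarrow> (complex \<times> complex \<Rightarrow> complex) \<Rightarrow> bool" where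
  "vanishes_near_branches q m T f \<longleftrightarrow> (\<forall>j\<in>T. \<exists>\<^sub>F s in at 0.
     vanishes_to_order (restrict_graph (- q j + monom s (m j)) f)
       (bracket_order q m T (- q j + monom s (m j))))"

lemma vanishes_near_branches_quotient:
  assumes T: "finite T" "j \<notin> T" "S \<subseteq> T"
    and m: "\<And>i. i \<in> T \<Longrightarrow> 0 < m i" "\<And>i. i \<in> T \<Longrightarrow> m i \<le> m j"
    and q0: "\<And>i. i \<in> T \<Longrightarrow> poly (q i) 0 = 0"
    and f: "vanishes_near_branches q m (insert j T) f"
    and g: "holomorphic_germ g" and \<alpha>: "holomorphic_germ \<alpha>"
    and f_eq: "\<forall>\<^sub>F z in nhds 0.
      f z = branch q j z * g z + fst z ^ m j * (\<alpha> z * bracket_generator q m T S z)"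
  shows "vanishes_near_branches q m T g"
  unfolding vanishes_near_branches_def
proof
  fix i assume i_in_T: "i \<in> T"
  define c where "c s = - q i + monom s (m i)" for s
  have "\<exists>\<^sub>F s in at 0.
      vanishes_to_order (restrict_graph (c s) f) (bracket_order q m (insert j T) (c s))"
    using f i_in_T by (simp add: vanishes_near_branches_def c_def)
  moreover have "\<forall>\<^sub>F s in at 0. s \<noteq> - coeff (q j - q i) (m i)"
    by (rule eventually_neq_at_within)
  ultimately have "\<exists>\<^sub>F s in at 0.
      vanishes_to_order (restrict_graph (c s) f) (bracket_order q m (insert j T) (c s)) \<and>
      s \<noteq> - coeff (q j - q i) (m i)"
    by (rule frequently_eventually_frequently)
  then have "\<exists>\<^sub>F s in at 0. vanishes_to_order (restrict_graph (c s) g) (bracket_order q m T (c s))"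
  proof (rule frequently_elim1, elim conjE)
    fix s
    assume f_s: "vanishes_to_order (restrict_graph (c s) f) (bracket_order q m (insert j T) (c s))"
      and generic: "s \<noteq> - coeff (q j - q i) (m i)"
    have c_zero: "poly (c s) 0 = 0"
      using m(1)[OF i_in_T] q0[OF i_in_T] by (simp add: c_def poly_monom)
    have "coeff (c s + q j) (m i) \<noteq> 0"
      using generic by (simp add: c_def)
    moreover have "vanishes_to_order
        (restrict_graph (c s) (\<lambda>z. fst z ^ m j * (\<alpha> z * bracket_generator q m T S z)))
        (bracket_order q m (insert j T) (c s))"
      using vanishes_to_order_mult_bracket_generator[OF \<alpha> c_zero, of q m "insert j T" S] T
      by (simp add: product_generator_insert mult_ac)
    ultimately show "vanishes_to_order (restrict_graph (c s) g) (bracket_order q m T (c s))"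
      using vanishes_to_order_branch_quotient[OF T(1,2) g c_zero m(2)[OF i_in_T] _ f_s _ f_eq]
      by blast
  qed
  then show "\<exists>\<^sub>F s in at 0. vanishes_to_order (restrict_graph (- q i + monom s (m i)) g)
      (bracket_order q m T (- q i + monom s (m i)))"
    by (simp only: c_def)
qed

lemma bracket_order_near_maximal_branch:
  assumes "finite T" "j \<notin> T" "\<And>i. i \<in> T \<Longrightarrow> m i \<le> m j"
  shows "bracket_order q m (insert j T) (- q j + monom s (m j)) = bracket_order q m T (- q j) + m j"
proof -
  have "truncated_order (m j) (- q j + monom s (m j) + q j) = m j"
    using truncated_order_add_monom[of "m j" "m j" 0 s] by (simp add: truncated_order_def[of _ 0])
  then show ?thesis
    using assms
    by (simp add: bracket_order_insert bracket_order_add_monom del: uminus_add_conv_diff)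
qed

proposition in_bracket_ideal_if_vanishes_near_branches:
  assumes "finite T" "\<And>j. j \<in> T \<Longrightarrow> 0 < m j" "\<And>j. j \<in> T \<Longrightarrow> poly (q j) 0 = 0"
    "holomorphic_germ f" "vanishes_near_branches q m T f"
  shows "in_bracket_ideal q m T f"
  using assms
proof (induction T arbitrary: f rule: finite_ranking_induct[where f = m])
  case empty
  then show ?case
    by (intro in_ideal_product_empty)
next
  case (insert j T)
  show ?case
  proof (cases "j \<in> T")
    case True
    then show ?thesis
      using insert by (simp add: insert_absorb)
  next
    case False
    have "\<exists>\<^sub>F s in at 0. vanishes_to_order (restrict_graph (- q j + monom s (m j)) f)
        (bracket_order q m (insert j T) (- q j + monom s (m j)))"
      using insert.prems(4) by (simp add: vanishes_near_branches_def)
    then have "\<exists>\<^sub>F s in at 0. vanishes_to_order (restrict_graph (- q j + monom s (m j)) f)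
        (bracket_order q m T (- q j) + m j)"
      using bracket_order_near_maximal_branch[of T j m] insert.hyps False by simp
    then have "vanishes_to_order (restrict_graph (- q j) f) (bracket_order q m T (- q j) + m j)"
      using insert.prems(2,3) by (intro vanishes_to_order_limit_graph) auto
    then obtain S \<alpha> g where S: "S \<subseteq> T" and \<alpha>: "holomorphic_germ \<alpha>" and g: "holomorphic_germ g"
      and f_eq: "\<forall>\<^sub>F z in nhds 0. f z =
        branch q j z * g z + fst z ^ m j * (\<alpha> z * bracket_generator q m T S z)"
      using branch_decomposition[of f q j m T] insert.prems(2,3) by auto
    have "vanishes_near_branches q m T g"
      using insert.prems(1-3) insert.hyps(2)
      by (intro vanishes_near_branches_quotient[OF insert.hyps(1) False S _ _ _
            insert.prems(4) g \<alpha> f_eq]) auto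
    then have g_ideal: "in_bracket_ideal q m T g"
      using insert g by simp
    have gen_ideal: "in_bracket_ideal q m T (\<lambda>z. \<alpha> z * bracket_generator q m T S z)"
      using insert.hyps(1) S \<alpha> by (rule in_ideal_product_generator)
    show ?thesis
      by (rule in_ideal_product_insert[OF insert.hyps(1) False g_ideal gen_ideal f_eq])
  qed
qed

section \<open>Comparison with the bracket at real points\<close>

definition complex_point :: "real \<times> real \<Rightarrow> complex \<times> complex" where
  "complex_point z = (of_real (fst z), of_real (snd z))"

lemma filterlim_complex_point: "filterlim complex_point (nhds 0) (nhds 0)"
proof -
  have "isCont complex_point 0"
    unfolding complex_point_def[abs_def] by (intro continuous_intros)
  moreover have "complex_point 0 = 0"
    by (simp add: complex_point_def zero_prod_def)
  ultimately show ?thesis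
    unfolding isCont_def tendsto_at_iff_tendsto_nhds by simp
qed

lemma norm_bracket_generator_le:
  "norm (bracket_generator q m T S (complex_point z)) \<le> norm (bracket q m T (complex_point z))"
  unfolding product_generator_def bracket_def prod_norm[symmetric]
proof (intro prod_mono conjI)
  fix k
  define w where "w = branch q k (complex_point z) + \<i> * fst (complex_point z) ^ m k"
  have "branch q k (complex_point z) = of_real (Re w)"
    "fst (complex_point z) ^ m k = of_real (Im w)"
    by (simp_all add: w_def branch_def complex_point_def complex_eq_iff flip: of_real_power)
  then show "norm (if k \<in> S then branch q k (complex_point z) else fst (complex_point z) ^ m k)
      \<le> norm (branch q k (complex_point z) + \<i> * fst (complex_point z) ^ m k)"
    using abs_Re_le_cmod[of w] abs_Im_le_cmod[of w]
    by (simp add: w_def[symmetric] flip: complex_eq)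
qed simp

lemma bracket_ideal_bigo_bracket:
  assumes "finite T" "in_bracket_ideal q m T f"
  shows "(\<lambda>z. f (complex_point z)) \<in> O[at 0](\<lambda>z. bracket q m T (complex_point z))"
proof -
  obtain h where h: "\<And>S. holomorphic_germ (h S)"
    and f_eq: "\<forall>\<^sub>F z in nhds 0. f z = (\<Sum>S\<in>Pow T. h S z * bracket_generator q m T S z)"
    using assms(2) by (auto simp: in_ideal_product_def)
  have to_nhds: "filterlim complex_point (nhds 0) (at 0)"
    using filterlim_complex_point by (rule filterlim_mono) (simp_all add: at_within_def)
  have "(\<lambda>z. \<Sum>S\<in>Pow T. h S (complex_point z) * bracket_generator q m T S (complex_point z))
      \<in> O[at 0](\<lambda>z. bracket q m T (complex_point z))"
  proof (rule big_sum_in_bigo)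
    fix S
    have "((\<lambda>z. h S (complex_point z) / 1) \<longlongrightarrow> h S 0) (at 0)"
      using filterlim_compose[OF holomorphic_germ_tendsto[OF h] to_nhds] by simp
    then have "(\<lambda>z. h S (complex_point z)) \<in> O[at 0](\<lambda>_. 1)"
      by (rule bigoI_tendsto) simp
    moreover have "(\<lambda>z. bracket_generator q m T S (complex_point z))
        \<in> O[at 0](\<lambda>z. bracket q m T (complex_point z))"
      by (intro landau_o.big_mono always_eventually allI norm_bracket_generator_le)
    ultimately have "(\<lambda>z. h S (complex_point z) * bracket_generator q m T S (complex_point z))
        \<in> O[at 0](\<lambda>z. 1 * bracket q m T (complex_point z))"
      by (rule landau_o.big.mult)
    then show "(\<lambda>z. h S (complex_point z) * bracket_generator q m T S (complex_point z))
        \<in> O[at 0](\<lambda>z. bracket q m T (complex_point z))"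
      by simp
  qed
  moreover have eq: "\<forall>\<^sub>F z in at 0. f (complex_point z)
      = (\<Sum>S\<in>Pow T. h S (complex_point z) * bracket_generator q m T S (complex_point z))"
    using f_eq to_nhds by (rule eventually_compose_filterlim)
  ultimately show ?thesis
    by (simp add: landau_o.big.in_cong[OF eq])
qed

lemma vanishes_to_exact_order_bigtheta:
  assumes "vanishes_to_exact_order F n"
  shows "(\<lambda>x. F (of_real x)) \<in> \<Theta>[at_right 0](\<lambda>x. of_real x ^ n)"
proof -
  obtain G where G: "G analytic_on {0}" "G 0 \<noteq> 0" and F_eq: "\<forall>\<^sub>F z in nhds 0. F z = z ^ n * G z"
    using assms by (auto simp: vanishes_to_exact_order_def)
  have real_axis: "filterlim complex_of_real (nhds 0) (at_right 0)"
    using tendsto_of_real[OF tendsto_ident_at[of 0 "{0<..}"]] by simp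
  have "(G \<longlongrightarrow> G 0) (nhds 0)"
    using analytic_at_imp_isCont[OF G(1)] by (simp add: isCont_def tendsto_at_iff_tendsto_nhds)
  then have "((\<lambda>x. norm (G (of_real x) / 1)) \<longlongrightarrow> norm (G 0)) (at_right (0::real))"
    using tendsto_norm[OF filterlim_compose[OF _ real_axis]] by simp
  then have "(\<lambda>x. G (of_real x)) \<in> \<Theta>[at_right (0::real)](\<lambda>_. 1)"
    using G(2) by (intro bigthetaI_tendsto_norm[of "norm (G 0)"]) auto
  then have "(\<lambda>x. of_real x ^ n * G (of_real x)) \<in> \<Theta>[at_right 0](\<lambda>x. of_real x ^ n * 1)"
    by (intro landau_theta.mult) simp_all
  moreover have eq: "\<forall>\<^sub>F x in at_right 0. F (of_real x) = of_real x ^ n * G (of_real x)"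
    using F_eq real_axis by (rule eventually_compose_filterlim)
  ultimately show ?thesis
    by (simp add: landau_theta.in_cong[OF eq])
qed

definition comparable_to_bracket ::
  "complex poly poly \<Rightarrow> ('i \<Rightarrow> real poly) \<Rightarrow> ('i \<Rightarrow> nat) \<Rightarrow> 'i set \<Rightarrow> bool" where
  "comparable_to_bracket P q m T \<longleftrightarrow>
     (\<lambda>z::real \<times> real. eval2 P (of_real (fst z)) (of_real (snd z)))
       \<in> \<Theta>[at 0](\<lambda>z. bracket q m T (complex_point z))"

lemma filterlim_real_graph:
  fixes c :: "real poly"
  assumes "poly c 0 = 0"
  shows "filterlim (\<lambda>x. (x, poly c x)) (at 0) (at_right 0)"
  unfolding filterlim_at
proof
  show "\<forall>\<^sub>F x in at_right 0. (x, poly c x) \<in> UNIV \<and> (x, poly c x) \<noteq> 0"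
    using eventually_at_right_less[of "0 :: real"] by eventually_elim (simp add: zero_prod_def)
  have "((\<lambda>x. (x, poly c x)) \<longlongrightarrow> (0, poly c 0)) (at_right 0)"
    by (intro tendsto_intros)
  then show "((\<lambda>x. (x, poly c x)) \<longlongrightarrow> 0) (at_right 0)"
    using assms by (simp add: zero_prod_def)
qed

lemma comparable_to_bracket_on_graph:
  assumes "comparable_to_bracket P q m T" "poly c 0 = 0"
  shows "(\<lambda>x. eval2 P (of_real x) (of_real (poly c x)))
    \<in> \<Theta>[at_right 0](\<lambda>x. of_real x ^ bracket_order q m T c)"
proof -
  have "(\<lambda>x. eval2 P (of_real x) (of_real (poly c x)))
      \<in> \<Theta>[at_right 0](\<lambda>x. bracket q m T (complex_point (x, poly c x)))"
    using landau_theta.compose[OF assms(1)[unfolded comparable_to_bracket_def]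
        filterlim_real_graph[OF assms(2)]] by simp
  also have "(\<lambda>x. bracket q m T (complex_point (x, poly c x)))
      \<in> \<Theta>[at_right 0](\<lambda>x. of_real x ^ bracket_order q m T c)"
    using vanishes_to_exact_order_bigtheta[OF vanishes_to_exact_order_bracket[of c q m T]]
    by (simp add: restrict_graph_def complex_point_def)
  finally show ?thesis .
qed

lemma inverse_bigo_quotient_on_graph:
  assumes P: "comparable_to_bracket P q m T" and f: "holomorphic_germ f" and c_zero: "poly c 0 = 0"
    and not_vanishes: "\<not> vanishes_to_order (restrict_graph c f) (bracket_order q m T c)"
  shows "(\<lambda>x. 1 / of_real x)
    \<in> O[at_right 0](\<lambda>x. f (of_real x, of_real (poly c x))
      / eval2 P (of_real x) (of_real (poly c x)))"
proof -
  define N where "N = bracket_order q m T c"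
  obtain n where "n < N" and exact: "vanishes_to_exact_order (restrict_graph c f) n"
    using vanishes_to_exact_order_if_not_vanishes[OF analytic_on_restrict_graph[OF f c_zero]
        not_vanishes] unfolding N_def .
  have unit_interval: "\<forall>\<^sub>F x in at_right 0. x \<in> {0<..<1::real}"
    by (rule eventually_at_right_real) simp
  have "(\<lambda>x. f (of_real x, of_real (poly c x))) \<in> \<Theta>[at_right 0](\<lambda>x. of_real x ^ n)"
    using vanishes_to_exact_order_bigtheta[OF exact] by (simp add: restrict_graph_def)
  then have f_order: "(\<lambda>x. of_real x ^ n) \<in> O[at_right 0](\<lambda>x. f (of_real x, of_real (poly c x)))"
    unfolding bigtheta_sym[of "\<lambda>x. f (of_real x, of_real (poly c x))"] by (rule bigthetaD1)
  have P_order: "(\<lambda>x. eval2 P (of_real x) (of_real (poly c x))) \<in> \<Theta>[at_right 0](\<lambda>x. of_real x ^ N)"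
    using comparable_to_bracket_on_graph[OF P c_zero] by (simp add: N_def)
  have power_nonzero: "\<forall>\<^sub>F x in at_right 0. complex_of_real x ^ N \<noteq> 0"
    using unit_interval by eventually_elim simp
  then have P_nonzero: "\<forall>\<^sub>F x in at_right 0. eval2 P (of_real x) (of_real (poly c x)) \<noteq> 0"
    using eventually_nonzero_bigtheta[OF P_order] by simp
  have "(\<lambda>x. 1 / complex_of_real x) \<in> O[at_right 0](\<lambda>x. of_real x ^ n / of_real x ^ N)"
  proof (rule landau_o.big_mono, use unit_interval in eventually_elim)
    case (elim x)
    have "x ^ N \<le> x ^ Suc n"
      using elim \<open>n < N\<close> by (intro power_decreasing) auto
    then show ?case
      using elim by (simp add: norm_divide norm_power field_simps)
  qed
  also have "(\<lambda>x. complex_of_real x ^ n / of_real x ^ N)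
      \<in> O[at_right 0](\<lambda>x. f (of_real x, of_real (poly c x))
      / eval2 P (of_real x) (of_real (poly c x)))"
    by (rule landau_o.big.divide[OF power_nonzero P_nonzero f_order bigthetaD1[OF P_order]])
  finally show ?thesis .
qed

section \<open>Integrability along graphs\<close>

lemma nn_integral_inverse_at_right_0:
  assumes "\<delta> > 0"
  shows "(\<integral>\<^sup>+x. indicator {0<..<\<delta>} x * ennreal (1 / x) \<partial>lborel) = \<infinity>"
proof (rule ccontr)
  assume "(\<integral>\<^sup>+x. indicator {0<..<\<delta>} x * ennreal (1 / x) \<partial>lborel) \<noteq> \<infinity>"
  then obtain I where "I \<ge> 0"
    and I_eq: "(\<integral>\<^sup>+x. indicator {0<..<\<delta>} x * ennreal (1 / x) \<partial>lborel) = ennreal I"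
    by (cases "\<integral>\<^sup>+x. indicator {0<..<\<delta>} x * ennreal (1 / x) \<partial>lborel" rule: ennreal_cases) auto
  define b where "b = \<delta> / 2"
  define a where "a = b * exp (- (I + 1))"
  have b_range: "0 < b" "b < \<delta>"
    using assms by (auto simp: b_def)
  have a_range: "0 < a" "a \<le> b"
    using b_range \<open>I \<ge> 0\<close> by (auto simp: a_def)
  have "(\<integral>\<^sup>+x. ennreal (1 / x) * indicator {a..b} x \<partial>lborel) = ennreal (ln b - ln a)"
  proof (rule nn_integral_FTC_Icc)
    show "(ln has_real_derivative 1 / x) (at x)" if "x \<in> {a..b}" for x
      using that a_range by (auto intro!: derivative_eq_intros)
  qed (use a_range in auto)
  also have "ln b - ln a = I + 1"
    using b_range by (simp add: a_def ln_mult)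
  finally have "ennreal (I + 1) = (\<integral>\<^sup>+x. ennreal (1 / x) * indicator {a..b} x \<partial>lborel)"
    by simp
  also have "\<dots> \<le> (\<integral>\<^sup>+x. indicator {0<..<\<delta>} x * ennreal (1 / x) \<partial>lborel)"
    by (intro nn_integral_mono) (use a_range b_range in \<open>auto split: split_indicator\<close>)
  finally show False
    using I_eq \<open>I \<ge> 0\<close> by (simp add: ennreal_le_iff)
qed

lemma nn_integral_eq_infinity_if_ge_inverse:
  fixes h :: "real \<Rightarrow> ennreal"
  assumes "k > 0" "\<forall>\<^sub>F x in at_right 0. ennreal (k / x) \<le> h x"
  shows "(\<integral>\<^sup>+x. indicator {0<..} x * h x \<partial>lborel) = \<infinity>"
proof -
  obtain \<delta> where "\<delta> > 0" and h_ge: "\<And>x. 0 < x \<Longrightarrow> x < \<delta> \<Longrightarrow> ennreal (k / x) \<le> h x"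
    using assms(2) unfolding eventually_at_right_field by auto
  have "ennreal k * (\<integral>\<^sup>+x. indicator {0<..<\<delta>} x * ennreal (1 / x) \<partial>lborel)
      = (\<integral>\<^sup>+x. ennreal k * (indicator {0<..<\<delta>} x * ennreal (1 / x)) \<partial>lborel)"
    by (rule nn_integral_cmult[symmetric]) measurable
  also have "\<dots> \<le> (\<integral>\<^sup>+x. indicator {0<..} x * h x \<partial>lborel)"
  proof (rule nn_integral_mono)
    fix x :: real
    show "ennreal k * (indicator {0<..<\<delta>} x * ennreal (1 / x)) \<le> indicator {0<..} x * h x"
      using h_ge[of x] \<open>k > 0\<close> by (cases "0 < x \<and> x < \<delta>") (auto simp: ennreal_mult[symmetric])
  qed
  finally show ?thesis
    using \<open>k > 0\<close>
    by (simp add: nn_integral_inverse_at_right_0[OF \<open>\<delta> > 0\<close>] ennreal_mult_top top_unique)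
qed

text \<open>The factor \<open>x\<^sup>n\<close> is the Jacobian of \<open>(x, s) \<mapsto> (x, \<gamma>(x) + s x\<^sup>n)\<close>.\<close>
lemma AE_nn_integral_pencil_finite:
  fixes H :: "real \<times> real \<Rightarrow> ennreal" and \<gamma> :: "real \<Rightarrow> real"
  assumes [measurable]: "H \<in> borel_measurable borel" "\<gamma> \<in> borel_measurable borel"
    and finite: "(\<integral>\<^sup>+z. H z \<partial>lborel) < \<infinity>"
  shows "AE s in lborel.
    (\<integral>\<^sup>+x. indicator {0<..} x * (ennreal (x ^ n) * H (x, \<gamma> x + s * x ^ n)) \<partial>lborel) < \<infinity>"
proof -
  define J where "J s x = indicator {0<..} x * (ennreal (x ^ n) * H (x, \<gamma> x + s * x ^ n))" for s x
  have "(\<integral>\<^sup>+s. J s x \<partial>lborel) \<le> (\<integral>\<^sup>+y. H (x, y) \<partial>lborel)" for x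
  proof (cases "x > 0")
    case True
    have "(\<integral>\<^sup>+y. H (x, y) \<partial>lborel) = ennreal \<bar>x ^ n\<bar> * (\<integral>\<^sup>+s. H (x, \<gamma> x + x ^ n * s) \<partial>lborel)"
      using True by (intro nn_integral_real_affine) auto
    also have "\<dots> = (\<integral>\<^sup>+s. J s x \<partial>lborel)"
      using True by (subst nn_integral_cmult[symmetric]) (auto simp: J_def mult_ac)
    finally show ?thesis
      by simp
  qed (simp add: J_def)
  then have "(\<integral>\<^sup>+x. \<integral>\<^sup>+s. J s x \<partial>lborel \<partial>lborel) \<le> (\<integral>\<^sup>+x. \<integral>\<^sup>+y. H (x, y) \<partial>lborel \<partial>lborel)"
    by (rule nn_integral_mono)
  also have "\<dots> = (\<integral>\<^sup>+z. H z \<partial>(lborel \<Otimes>\<^sub>M lborel))"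
    by (rule lborel.nn_integral_fst) (simp add: lborel_prod)
  also have "\<dots> < \<infinity>"
    using finite by (simp add: lborel_prod)
  also have "(\<integral>\<^sup>+x. \<integral>\<^sup>+s. J s x \<partial>lborel \<partial>lborel) = (\<integral>\<^sup>+s. \<integral>\<^sup>+x. J s x \<partial>lborel \<partial>lborel)"
    unfolding J_def by (rule lborel_pair.Fubini'[symmetric]) measurable
  finally have "(\<integral>\<^sup>+s. \<integral>\<^sup>+x. J s x \<partial>lborel \<partial>lborel) \<noteq> \<infinity>"
    by simp
  from nn_integral_PInf_AE[OF _ this] show ?thesis
    by (simp add: J_def top.not_eq_extremum)
qed

lemma inverse_le_power_mult_powr:
  fixes k u x :: real
  assumes "0 < k" "0 < x" "x < 1" "n \<le> K" "k / x \<le> u"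
  shows "k ^ Suc K / x \<le> x ^ n * u powr (real K + 1)"
proof -
  have "u > 0"
    using assms divide_pos_pos[of k x] by linarith
  have "k ^ Suc K / x = x ^ K * (k / x) ^ Suc K"
    using assms(2) by (simp add: power_divide)
  also have "\<dots> \<le> x ^ n * u ^ Suc K"
    using assms by (intro mult_mono power_decreasing power_mono) auto
  also have "u ^ Suc K = u powr (real K + 1)"
    using powr_realpow[OF \<open>u > 0\<close>, of "Suc K"] by (simp add: add.commute)
  finally show ?thesis .
qed

lemma vanishes_to_order_if_nn_integral_finite:
  assumes P: "comparable_to_bracket P q m T" and c_zero: "poly c 0 = 0" and "n \<le> K"
    and Q: "conv_ps Q" and U: "open U" "0 \<in> U"
    and finite: "(\<integral>\<^sup>+x. indicator {0<..} x * (ennreal (x ^ n) * ennreal (indicator U (x, poly c x) *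
      norm (quot_real Q P (x, poly c x)) powr (real K + 1))) \<partial>lborel) < \<infinity>"
  shows "vanishes_to_order (restrict_graph c (\<lambda>z. ps_eval Q (fst z) (snd z)))
    (bracket_order q m T c)"
proof (rule ccontr)
  define u where "u x = norm (quot_real Q P (x, poly c x))" for x
  assume "\<not> ?thesis"
  then have "(\<lambda>x. 1 / of_real x) \<in> O[at_right 0](\<lambda>x. quot_real Q P (x, poly c x))"
    using inverse_bigo_quotient_on_graph[OF P holomorphic_germ_ps_eval[OF Q] c_zero]
    by (simp add: quot_real_def)
  then obtain C where "C > 0"
    and u_ge: "\<forall>\<^sub>F x in at_right 0. norm (1 / complex_of_real x) \<le> C * u x"
    unfolding u_def by (elim landau_o.bigE)
  have "\<forall>\<^sub>F x in at_right 0. (x, poly c x) \<in> U"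
    using filterlim_real_graph[OF c_zero] U by (auto simp: filterlim_at dest: topological_tendstoD)
  moreover have "\<forall>\<^sub>F x in at_right 0. x \<in> {0<..<1::real}"
    by (rule eventually_at_right_real) simp
  ultimately have "\<forall>\<^sub>F x in at_right 0. ennreal ((1 / C) ^ Suc K / x)
      \<le> ennreal (x ^ n) * ennreal (indicator U (x, poly c x) * u x powr (real K + 1))"
    using u_ge
  proof eventually_elim
    case (elim x)
    then have "1 / C / x \<le> u x"
      using \<open>C > 0\<close> by (simp add: norm_divide field_simps)
    with elim show ?case
      using inverse_le_power_mult_powr[of "1 / C" x n K "u x"] \<open>C > 0\<close> \<open>n \<le> K\<close>
      by (simp add: ennreal_mult[symmetric] ennreal_leI)
  qed
  from nn_integral_eq_infinity_if_ge_inverse[OF _ this] finite show False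
    using \<open>C > 0\<close> by (simp add: u_def)
qed

lemma AE_vanishes_along_pencil:
  assumes P: "comparable_to_bracket P q m T" and p_zero: "poly p 0 = 0" and n: "0 < n" "n \<le> K"
    and Q: "conv_ps Q" and Lp: "Lp_loc (real K + 1) (quot_real Q P)"
  shows "AE s in lborel. vanishes_to_order
    (restrict_graph (p + monom s n) (\<lambda>z. ps_eval Q (fst z) (snd z)))
    (bracket_order q m T (p + monom s n))"
proof -
  obtain U where U: "open U" "0 \<in> U"
    and int: "integrable lborel (\<lambda>z. indicator U z * norm (quot_real Q P z) powr (real K + 1))"
    using Lp by (auto simp: Lp_loc_def set_integrable_def zero_prod_def)
  define H where "H z = ennreal (indicator U z * norm (quot_real Q P z) powr (real K + 1))" for z
  have "(\<integral>\<^sup>+z. ennreal (norm (indicator U z * norm (quot_real Q P z) powr (real K + 1)))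
      \<partial>lborel) < \<infinity>"
    using int unfolding integrable_iff_bounded by blast
  then have "(\<integral>\<^sup>+z. H z \<partial>lborel) < \<infinity>"
    by (simp add: H_def)
  moreover have "H \<in> borel_measurable borel"
    using borel_measurable_integrable[OF int] unfolding H_def[abs_def] by simp
  moreover have "poly p \<in> borel_measurable borel"
    by (intro borel_measurable_continuous_onI continuous_intros)
  ultimately have "AE s in lborel.
      (\<integral>\<^sup>+x. indicator {0<..} x * (ennreal (x ^ n) * H (x, poly p x + s * x ^ n)) \<partial>lborel) < \<infinity>"
    by (intro AE_nn_integral_pencil_finite)
  then show ?thesis
  proof eventually_elim
    case (elim s)
    have pencil: "poly p x + s * x ^ n = poly (p + monom s n) x" for x
      by (simp add: poly_monom)
    have "poly (p + monom s n) 0 = 0"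
      using p_zero n(1) by (simp add: poly_monom)
    then show ?case
      using elim unfolding pencil H_def
      by (rule vanishes_to_order_if_nn_integral_finite[OF P _ n(2) Q U])
  qed
qed

lemma frequently_at_if_AE_lborel:
  assumes "AE s in lborel. Q s"
  shows "\<exists>\<^sub>F s in at (a :: real). Q s"
  unfolding frequently_def
proof
  assume "\<forall>\<^sub>F s in at a. \<not> Q s"
  then obtain d where "d > 0" "\<And>s. s \<noteq> a \<Longrightarrow> dist s a < d \<Longrightarrow> \<not> Q s"
    by (auto simp: eventually_at)
  then have "\<not> Q s" if "s \<in> {a<..<a + d}" for s
    using that by (auto simp: dist_real_def)
  with assms have "AE s in lborel. s \<notin> {a<..<a + d}"
    by (auto elim!: eventually_mono)
  then have "{a<..<a + d} \<in> null_sets lborel"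
    by (subst AE_iff_null_sets) simp_all
  then show False
    using \<open>d > 0\<close> by (auto simp: null_sets_def)
qed

section \<open>Locally bounded quotients\<close>

lemma eval2_pCons: "eval2 (pCons a P) x y = poly a x + y * eval2 P x y"
  by (simp add: eval2_def map_poly_pCons)

lemma continuous_on_eval2 [continuous_intros]:
  assumes "continuous_on A f" "continuous_on A g"
  shows "continuous_on A (\<lambda>z. eval2 P (f z) (g z))"
proof (induction P)
  case 0
  then show ?case
    by (simp add: eval2_def)
next
  case (pCons a P)
  then show ?case
    using assms by (auto simp: eval2_pCons intro!: continuous_intros)
qed

lemma set_borel_measurable_subset:
  fixes f :: "'a \<Rightarrow> 'b :: {second_countable_topology, real_normed_vector}"
  assumes "set_borel_measurable M A f" "B \<in> sets M" "B \<subseteq> A"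
  shows "set_borel_measurable M B f"
proof -
  have "(\<lambda>x. indicator B x *\<^sub>R (indicator A x *\<^sub>R f x)) \<in> borel_measurable M"
    using borel_measurable_indicator[OF assms(2)] assms(1) unfolding set_borel_measurable_def
    by (rule borel_measurable_scaleR)
  also have "(\<lambda>x. indicator B x *\<^sub>R (indicator A x *\<^sub>R f x)) = (\<lambda>x. indicator B x *\<^sub>R f x)"
    using assms(3) by (auto simp: fun_eq_iff split: split_indicator)
  finally show ?thesis
    by (simp add: set_borel_measurable_def)
qed

lemma set_borel_measurable_quot_real:
  assumes "conv_ps Q"
  obtains U where "open U" "0 \<in> U" "set_borel_measurable lborel U (quot_real Q P)"
proof -
  obtain S where S: "open S" "0 \<in> S"
    and ps: "(\<lambda>z. ps_eval Q (fst z) (snd z)) jointly_holomorphic_on S"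
    using holomorphic_germ_ps_eval[OF assms] by (auto simp: holomorphic_germ_def)
  define U where "U = complex_point -` S"
  have cont: "continuous_on A complex_point" for A
    unfolding complex_point_def[abs_def] by (intro continuous_intros)
  have U: "open U" "0 \<in> U"
    unfolding U_def using S cont by (auto simp: complex_point_def zero_prod_def intro: open_vimage)
  have "continuous_on U (\<lambda>z. ps_eval Q (fst (complex_point z)) (snd (complex_point z)))"
    by (rule continuous_on_compose2[OF jointly_holomorphic_on_imp_continuous_on[OF ps] cont])
       (auto simp: U_def)
  then have "(\<lambda>z. indicator U z *\<^sub>R ps_eval Q (of_real (fst z)) (of_real (snd z)))
      \<in> borel_measurable borel"
    using U(1) by (intro borel_measurable_continuous_on_indicator) (auto simp: complex_point_def)
  moreover have "(\<lambda>z::real \<times> real. eval2 P (of_real (fst z)) (of_real (snd z)))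
      \<in> borel_measurable borel"
    by (intro borel_measurable_continuous_onI continuous_intros)
  ultimately have "(\<lambda>z. (indicator U z *\<^sub>R ps_eval Q (of_real (fst z)) (of_real (snd z))) /
      eval2 P (of_real (fst z)) (of_real (snd z))) \<in> borel_measurable borel"
    by (rule borel_measurable_divide)
  then have "set_borel_measurable lborel U (quot_real Q P)"
    by (simp add: set_borel_measurable_def quot_real_def case_prod_unfold scaleR_conv_of_real)
  with U show ?thesis
    by (rule that)
qed

lemma Linf_loc_imp_Lp_loc:
  assumes "Linf_loc f" "p \<ge> 0"
  shows "Lp_loc p f"
proof -
  obtain U C where U: "open U" "(0,0) \<in> U" and meas: "set_borel_measurable lborel U f"
    and bound: "AE z in lborel. z \<in> U \<longrightarrow> norm (f z) \<le> C"
    using assms(1) by (auto simp: Linf_loc_def)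
  define V where "V = U \<inter> ball 0 1"
  have V: "open V" "(0,0) \<in> V"
    using U by (auto simp: V_def zero_prod_def[symmetric])
  have "emeasure lborel V \<le> emeasure lborel (ball (0 :: real \<times> real) 1)"
    by (rule emeasure_mono) (auto simp: V_def)
  also have "\<dots> < \<infinity>"
    by (rule emeasure_lborel_ball_finite)
  finally have finite: "emeasure lborel V < \<infinity>" .
  have meas_V: "set_borel_measurable lborel V f"
    using meas by (rule set_borel_measurable_subset) (use V(1) in \<open>auto simp: V_def\<close>)
  have "set_integrable lborel V (\<lambda>z. norm (f z) powr p)"
  proof (rule set_integrable_bound)
    show "set_integrable lborel V (\<lambda>z. C powr p)"
      using finite V(1) by (simp add: set_integrable_def)
    have [measurable]: "V \<in> sets borel" "(\<lambda>z. indicator V z *\<^sub>R f z) \<in> borel_measurable borel"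
      using V(1) meas_V by (simp_all add: set_borel_measurable_def)
    have "(\<lambda>z. indicator V z *\<^sub>R norm (indicator V z *\<^sub>R f z) powr p) \<in> borel_measurable lborel"
      by measurable
    also have "(\<lambda>z. indicator V z *\<^sub>R norm (indicator V z *\<^sub>R f z) powr p)
        = (\<lambda>z. indicator V z *\<^sub>R norm (f z) powr p)"
      by (auto simp: fun_eq_iff split: split_indicator)
    finally show "set_borel_measurable lborel V (\<lambda>z. norm (f z) powr p)"
      by (simp add: set_borel_measurable_def)
    show "AE z in lborel. z \<in> V \<longrightarrow> norm (norm (f z) powr p) \<le> norm (C powr p)"
      using bound by eventually_elim (use assms(2) in \<open>auto simp: V_def intro!: powr_mono2\<close>)
  qed
  with V meas_V show ?thesis
    by (auto simp: Lp_loc_def)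
qed

lemma Linf_loc_quot_real:
  assumes "conv_ps Q" and bigo: "(\<lambda>z. ps_eval Q (of_real (fst z)) (of_real (snd z)))
    \<in> O[at 0](\<lambda>z. eval2 P (of_real (fst z)) (of_real (snd z)))"
  shows "Linf_loc (quot_real Q P)"
proof -
  obtain U where U: "open U" "0 \<in> U" "set_borel_measurable lborel U (quot_real Q P)"
    by (rule set_borel_measurable_quot_real[OF assms(1)])
  obtain C where "C > 0" and "\<forall>\<^sub>F z in at 0. norm (ps_eval Q (of_real (fst z)) (of_real (snd z)))
      \<le> C * norm (eval2 P (of_real (fst z)) (of_real (snd z)))"
    using landau_o.bigE[OF bigo] .
  then obtain V where V: "open V" "0 \<in> V"
    and norm_le: "\<And>z. z \<in> V \<Longrightarrow> z \<noteq> 0 \<Longrightarrow> norm (ps_eval Q (of_real (fst z)) (of_real (snd z)))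
      \<le> C * norm (eval2 P (of_real (fst z)) (of_real (snd z)))"
    by (auto simp: eventually_at_topological)
  have bound: "norm (quot_real Q P z) \<le> C" if "z \<in> V" "z \<noteq> 0" for z
    using norm_le[OF that] \<open>C > 0\<close>
    by (cases "eval2 P (of_real (fst z)) (of_real (snd z)) = 0")
       (auto simp: quot_real_def case_prod_unfold norm_divide divide_le_eq)
  have "AE z in lborel. z \<in> U \<inter> V \<longrightarrow> norm (quot_real Q P z) \<le> C"
    using AE_lborel_singleton[of "0 :: real \<times> real"] by eventually_elim (use bound in auto)
  moreover have "set_borel_measurable lborel (U \<inter> V) (quot_real Q P)"
    using U(3) by (rule set_borel_measurable_subset) (use U(1) V(1) in auto)
  ultimately show ?thesis
    unfolding Linf_loc_def using U V
    by (intro exI[of _ "U \<inter> V"] exI[of _ C]) (auto simp: zero_prod_def)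
qed

section \<open>The three ideals\<close>

abbreviation (input) bracket_prod_ideal ::
  "(nat \<Rightarrow> real poly) \<Rightarrow> (nat \<Rightarrow> nat) \<Rightarrow> nat \<Rightarrow> (nat \<Rightarrow> nat \<Rightarrow> complex) set" where
  "bracket_prod_ideal q m M \<equiv>
     prod_ideal M (\<lambda>j x y. y + poly (complex_poly (q j)) x) (\<lambda>j x y. x ^ m j)"

lemma bracket_prod_ideal_iff:
  "Q \<in> bracket_prod_ideal q m M \<longleftrightarrow>
     conv_ps Q \<and> in_bracket_ideal q m {..<M} (\<lambda>z. ps_eval Q (fst z) (snd z))"
  by (simp add: prod_ideal_iff_in_ideal_product branch_def[abs_def])

lemma I_p_subset_prod_ideal:
  assumes "comparable_to_bracket P q m {..<M}"
    and "\<And>j. j < M \<Longrightarrow> poly (q j) 0 = 0" "\<And>j. j < M \<Longrightarrow> 0 < m j" "\<And>j. j < M \<Longrightarrow> m j \<le> K"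
  shows "I_p (real K + 1) P \<subseteq> bracket_prod_ideal q m M"
proof
  fix Q assume "Q \<in> I_p (real K + 1) P"
  then have Q: "conv_ps Q" and Lp: "Lp_loc (real K + 1) (quot_real Q P)"
    by (auto simp: I_p_def)
  have "vanishes_near_branches q m {..<M} (\<lambda>z. ps_eval Q (fst z) (snd z))"
    unfolding vanishes_near_branches_def
    using assms(2-4)
    by (intro ballI frequently_at_if_AE_lborel
        AE_vanishes_along_pencil[OF assms(1) _ _ _ Q Lp]) auto
  then have "in_bracket_ideal q m {..<M} (\<lambda>z. ps_eval Q (fst z) (snd z))"
    using assms(2,3) Q
    by (intro in_bracket_ideal_if_vanishes_near_branches holomorphic_germ_ps_eval) auto
  with Q show "Q \<in> bracket_prod_ideal q m M"
    by (simp add: bracket_prod_ideal_iff)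
qed

lemma prod_ideal_subset_I_inf:
  assumes "comparable_to_bracket P q m {..<M}"
  shows "bracket_prod_ideal q m M \<subseteq> I_inf P"
proof
  fix Q assume "Q \<in> bracket_prod_ideal q m M"
  then have Q: "conv_ps Q" and ideal: "in_bracket_ideal q m {..<M} (\<lambda>z. ps_eval Q (fst z) (snd z))"
    by (auto simp: bracket_prod_ideal_iff)
  have "(\<lambda>z. ps_eval Q (of_real (fst z)) (of_real (snd z)))
      \<in> O[at 0](\<lambda>z. bracket q m {..<M} (complex_point z))"
    using bracket_ideal_bigo_bracket[OF finite_lessThan ideal] by (simp add: complex_point_def)
  also have "(\<lambda>z. bracket q m {..<M} (complex_point z))
      \<in> O[at 0](\<lambda>z. eval2 P (of_real (fst z)) (of_real (snd z)))"
    using assms unfolding comparable_to_bracket_def bigtheta_sym by (rule bigthetaD1)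
  finally show "Q \<in> I_inf P"
    using Linf_loc_quot_real[OF Q] Q by (simp add: I_inf_def)
qed

lemma I_inf_subset_I_p: "p \<ge> 0 \<Longrightarrow> I_inf P \<subseteq> I_p p P"
  using Linf_loc_imp_Lp_loc by (auto simp: I_inf_def I_p_def)

lemma comparable_to_bracketI:
  assumes "\<exists>e>0. \<exists>C. \<forall>x y::real. 0 < norm (x, y) \<and> norm (x, y) < e \<longrightarrow>
    (let Pv = eval2 P (of_real x) (of_real y);
         Bv = (\<Prod>j<M. of_real y + of_real (poly (q j) x) + \<i> * of_real x ^ m j)
     in Pv \<noteq> 0 \<and> Bv \<noteq> 0 \<and> norm (Pv / Bv) \<le> C \<and> norm (Bv / Pv) \<le> C)"
  shows "comparable_to_bracket P q m {..<M}"
proof -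
  define B where "B z = bracket q m {..<M} (complex_point z)" for z
  define p where "p z = eval2 P (of_real (fst z)) (of_real (snd z))" for z :: "real \<times> real"
  have B_eq: "B (x, y) = (\<Prod>j<M. of_real y + of_real (poly (q j) x) + \<i> * of_real x ^ m j)" for x y
    by (simp add: B_def bracket_def branch_def complex_point_def)
  obtain e C where "e > 0" and quotients: "\<And>z. 0 < norm z \<Longrightarrow> norm z < e \<Longrightarrow>
      p z \<noteq> 0 \<and> B z \<noteq> 0 \<and> norm (p z / B z) \<le> C \<and> norm (B z / p z) \<le> C"
    using assms unfolding Let_def B_eq[symmetric] p_def by (metis fst_conv snd_conv surj_pair)
  have near: "\<forall>\<^sub>F z::real \<times> real in at 0. 0 < norm z \<and> norm z < e"
    using \<open>e > 0\<close> by (auto simp: eventually_at)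
  then have "\<forall>\<^sub>F z in at 0. norm (p z) \<le> C * norm (B z)"
    "\<forall>\<^sub>F z in at 0. norm (B z) \<le> C * norm (p z)"
    by (eventually_elim, use quotients in \<open>fastforce simp: norm_divide divide_le_eq\<close>)+
  then have "p \<in> O[at 0](B)" "B \<in> O[at 0](p)"
    by (auto intro: bigoI)
  then show ?thesis
    unfolding comparable_to_bracket_def p_def[symmetric] B_def[symmetric]
    by (simp add: bigtheta_def bigomega_iff_bigo)
qed

theorem theorem5p6:
  fixes P :: "complex poly poly" and M :: nat
    and L :: "nat \<Rightarrow> nat" and q :: "nat \<Rightarrow> real poly"
  assumes no_zeros: "\<forall>x y. Im x > 0 \<and> Im y > 0 \<longrightarrow> eval2 P x y \<noteq> 0"
    and zero: "eval2 P 0 0 = 0"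
    and coprime: "\<forall>D. D dvd P \<and> D dvd conj2 P \<longrightarrow> is_unit D"
    and order: "M = vanishing_order P"
    and q0: "\<forall>j<M. poly (q j) 0 = 0"
    and q1: "\<forall>j<M. poly (pderiv (q j)) 0 > 0"
    and qdeg: "\<forall>j<M. degree (q j) < 2 * L j"
    and bracket: "\<exists>e>0. \<exists>C. \<forall>x y::real. 0 < norm (x, y) \<and> norm (x, y) < e \<longrightarrow>
        (let Pv = eval2 P (of_real x) (of_real y);
             Bv = (\<Prod>j<M. of_real y + of_real (poly (q j) x) + \<i> * of_real x ^ (2 * L j))
         in Pv \<noteq> 0 \<and> Bv \<noteq> 0 \<and> norm (Pv / Bv) \<le> C \<and> norm (Bv / Pv) \<le> C)"
  defines "K \<equiv> Max {2 * L j | j. j < M}"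
  shows "I_p (real K + 1) P \<subseteq>
           prod_ideal M (\<lambda>j x y. y + poly (map_poly of_real (q j)) x) (\<lambda>j x y. x ^ (2 * L j))
       \<and> prod_ideal M (\<lambda>j x y. y + poly (map_poly of_real (q j)) x) (\<lambda>j x y. x ^ (2 * L j))
           = I_p (real K + 1) P
       \<and> I_p (real K + 1) P = I_inf P"
proof -
  have comparable: "comparable_to_bracket P q (\<lambda>j. 2 * L j) {..<M}"
    using bracket by (rule comparable_to_bracketI)
  have "2 * L j \<le> K" if "j < M" for j
    unfolding K_def using that by (intro Max_ge) auto
  moreover have "0 < 2 * L j" if "j < M" for j
    using qdeg that by fastforce
  ultimately have "I_p (real K + 1) P \<subseteq> bracket_prod_ideal q (\<lambda>j. 2 * L j) M"
    using q0 by (intro I_p_subset_prod_ideal[OF comparable]) auto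
  moreover have "bracket_prod_ideal q (\<lambda>j. 2 * L j) M \<subseteq> I_inf P"
    by (rule prod_ideal_subset_I_inf[OF comparable])
  moreover have "I_inf P \<subseteq> I_p (real K + 1) P"
    by (rule I_inf_subset_I_p) simp
  ultimately show ?thesis
    by blast
qed

end
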